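(* Assume (A2) and (A3), and consider parameter values $(\eta,\sigma^2,b,d)$ for which $\rho<0$, so that the tail-index $\alpha$ (the unique $\alpha>0$ with $h(\alpha)=1$) is defined. Then: the tail-index $\alpha$ is strictly increasing in the batch-size $b$ and strictly decreasing in the stepsize $\eta$ and in the variance $\sigma^2$, provided that $\alpha\ge 1$; moreover, $\alpha$ is strictly decreasing in the dimension $d$.
   Context: Setup: integers $d,b\ge1$, stepsize $\eta>0$, i.i.d. data $(a_i,y_i)$ with $a_i\in\mathbb{R}^d$, $y_i\in\mathbb{R}$; $H_k=\sum_{i=b(k-1)+1}^{bk}a_ia_i^T$, $M_k=I_d-\frac{\eta}{b}H_k$, $q_k=\frac{\eta}{b}\sum_{i=b(k-1)+1}^{bk}a_iy_i$, SGD iterates $x_k=M_kx_{k-1}+q_k$. $\|\cdot\|$ is the Euclidean/spectral norm. $\Pi_k=M_k\cdots M_1$, $h(s)=\lim_{k\to\infty}(\mathbb{E}\|\Pi_k\|^s)^{1/k}$, $\rho=\lim_{k\to\infty}(2k)^{-1}\log\lambda_{\max}(\Pi_k^T\Pi_k)$. Assumptions: (A2) $y_i$ i.i.d. with continuous density supported on $\mathbb{R}$, all moments finite. (A3) $a_i\sim\mathcal{N}(0,\sigma^2I_d)$ i.i.d. Under these assumptions and $\rho<0$ there is a unique $\alpha>0$ with $h(\alpha)=1$, called the tail-index. *)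

theory Defs
  imports "HOL-Probability.Probability" "Jordan_Normal_Form.Char_Poly"
begin

text \<open>Parameters: stepsize eta, variance v (= sigma^2), batch size b, dimension d.
  All data are realised on one canonical probability space: a sample
  omega :: nat \<times> nat \<Rightarrow> real, where omega (i, j) is the j-th coordinate
  (j < d) of the data vector a_i (i \<ge> 1). All coordinates are i.i.d.
  N(0, v), i.e. a_i ~ N(0, v I_d) i.i.d.  The responses y_i do not enter
  h, rho or the tail-index, so they are not modelled.\<close>

definition data_space :: "real \<Rightarrow> (nat \<times> nat \<Rightarrow> real) measure" where
  "data_space v = PiM UNIV (\<lambda>_. density lborel (normal_density 0 (sqrt v)))"

definition avec :: "nat \<Rightarrow> (nat \<times> nat \<Rightarrow> real) \<Rightarrow> nat \<Rightarrow> real vec" where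
  "avec d \<omega> i = vec d (\<lambda>j. \<omega> (i, j))"

definition Hmat :: "nat \<Rightarrow> nat \<Rightarrow> (nat \<times> nat \<Rightarrow> real) \<Rightarrow> nat \<Rightarrow> real mat" where
  "Hmat b d \<omega> k = mat d d (\<lambda>(p, q). \<Sum>i\<in>{b * (k - 1) + 1 .. b * k}.
      (avec d \<omega> i) $ p * (avec d \<omega> i) $ q)"

definition Mmat :: "real \<Rightarrow> nat \<Rightarrow> nat \<Rightarrow> (nat \<times> nat \<Rightarrow> real) \<Rightarrow> nat \<Rightarrow> real mat" where
  "Mmat \<eta> b d \<omega> k = 1\<^sub>m d - (\<eta> / real b) \<cdot>\<^sub>m Hmat b d \<omega> k"

fun Pimat :: "real \<Rightarrow> nat \<Rightarrow> nat \<Rightarrow> (nat \<times> nat \<Rightarrow> real) \<Rightarrow> nat \<Rightarrow> real mat" where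
  "Pimat \<eta> b d \<omega> 0 = 1\<^sub>m d"
| "Pimat \<eta> b d \<omega> (Suc k) = Mmat \<eta> b d \<omega> (Suc k) * Pimat \<eta> b d \<omega> k"

definition vnorm :: "real vec \<Rightarrow> real" where
  "vnorm x = sqrt (scalar_prod x x)"

definition spec_norm :: "nat \<Rightarrow> real mat \<Rightarrow> real" where
  "spec_norm d A = Sup {vnorm (A *\<^sub>v x) | x. x \<in> carrier_vec d \<and> vnorm x = 1}"

definition lambda_max :: "real mat \<Rightarrow> real" where
  "lambda_max A = Max {l. eigenvalue A l}"

definition hfun :: "real \<Rightarrow> real \<Rightarrow> nat \<Rightarrow> nat \<Rightarrow> real \<Rightarrow> real" where
  "hfun \<eta> v b d s = lim (\<lambda>k. (\<integral>\<omega>. spec_norm d (Pimat \<eta> b d \<omega> k) powr s \<partial>data_space v)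
      powr (1 / real k))"

definition rho :: "real \<Rightarrow> real \<Rightarrow> nat \<Rightarrow> nat \<Rightarrow> real" where
  "rho \<eta> v b d = (THE r. AE \<omega> in data_space v.
      (\<lambda>k. ln (lambda_max (transpose_mat (Pimat \<eta> b d \<omega> k) * Pimat \<eta> b d \<omega> k))
         / (2 * real k)) \<longlonglongrightarrow> r)"

definition admissible :: "real \<Rightarrow> real \<Rightarrow> nat \<Rightarrow> nat \<Rightarrow> bool" where
  "admissible \<eta> v b d \<longleftrightarrow> \<eta> > 0 \<and> v > 0 \<and> b \<ge> 1 \<and> d \<ge> 1 \<and> rho \<eta> v b d < 0"

definition tail_index :: "real \<Rightarrow> real \<Rightarrow> nat \<Rightarrow> nat \<Rightarrow> real" where
  "tail_index \<eta> v b d = (THE \<alpha>. \<alpha> > 0 \<and> hfun \<eta> v b d \<alpha> = 1)"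

end

theory Submission
  imports Defs
begin

text \<open>By rotation invariance of the Gaussian law and independence of the batches,
  E |Pi_k u|^s = g(s)^k for every unit vector u, where g(s) = E |M_1 e_1|^s. Since the spectral norm of
  Pi_k lies between |Pi_k e_1| and sqrt d times the largest |Pi_k e_j|, this gives h(s) = g(s), and a Chernoff
  bound with small positive and negative s together with the Borel-Cantelli lemma gives
  rho = E log |M_1 e_1|. The function g is strictly convex with g(0) = 1, and its slope at 0 is rho, so for
  rho < 0 the tail-index is the point where g crosses 1 from below; hence it suffices to compare the
  functions g for different parameters. Enlarging d adds squares to |M_1 e_1|^2. For s \<ge> 1,
  g is strictly convex in eta * sigma^2 with value 1 at 0, and averaging leave-one-out batches
  (Jensen's inequality) shows that g strictly decreases in b.\<close>

section \<open>Gaussian product space\<close>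

text \<open>Both \<open>rho\<close> and \<open>tail_index\<close> are definite descriptions and
  \<open>hfun\<close> is a \<open>lim\<close>, so nothing can be compared before existence and
  uniqueness are settled. This is why \<open>rho\<close> is computed, although only its sign enters
  the comparison of tail-indices. The lower half of that computation needs a negative moment of |M_1
  e_1|, a norm that can come arbitrarily close to 0. It is bounded below by coordinate 0, which in a
  single Gaussian coordinate x has the form C - kappa x^2, with simple zeros or a double one; the
  power -1/4 of such a polynomial is integrable with room to spare. Moments are first taken in
  \<open>ennreal\<close>, so that rotation invariance and the product formula precede any
  integrability proof. The condition alpha >= 1 enters through convexity of x powr s, composed with
  a norm that is itself convex in the matrix; for the dimension, monotonicity of x powr s does the
  work. Convexity and Jensen alone give weak inequalities, so strictness always comes from an
  explicit open box of data. Stepsize and variance can be treated as one parameter because a step is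
  quadratic in the data.\<close>

text \<open>A rotation is a product of three shears, and each shear preserves Lebesgue measure by
  Fubini's theorem and translation invariance.\<close>

lemma nn_integral_rotate_lborel:
  fixes F :: "real \<Rightarrow> real \<Rightarrow> ennreal" and c s :: real
  assumes meas [measurable]: "case_prod F \<in> borel_measurable (borel \<Otimes>\<^sub>M borel)"
    and cs: "c\<^sup>2 + s\<^sup>2 = 1" and s: "s \<noteq> 0"
  shows "(\<integral>\<^sup>+x. \<integral>\<^sup>+y. F (c * x - s * y) (s * x + c * y) \<partial>lborel \<partial>lborel)
       = (\<integral>\<^sup>+x. \<integral>\<^sup>+y. F x y \<partial>lborel \<partial>lborel)"
proof -
  \<comment> \<open>With c and s the cosine and sine of an angle, t is the tangent of half the
    angle. The rotation is the shear by -t in x, then by s in y, then by -t in x.\<close>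
  define t where "t = (1 - c) / s"
  have ts: "t * s = 1 - c" using s by (simp add: t_def)
  have tc: "t * (1 + c) = s"
    using s cs by (simp add: t_def field_simps power2_eq_square)
  have translate: "(\<integral>\<^sup>+y. G (r * x + y) \<partial>lborel) = (\<integral>\<^sup>+y. G y \<partial>lborel)"
    if [measurable]: "G \<in> borel_measurable borel" for G :: "real \<Rightarrow> ennreal" and r x
    using nn_integral_real_affine[of G 1 "r * x"] by simp
  have swap: "(\<integral>\<^sup>+x. \<integral>\<^sup>+y. G x y \<partial>lborel \<partial>lborel) = (\<integral>\<^sup>+y. \<integral>\<^sup>+x. G x y \<partial>lborel \<partial>lborel)"
    if [measurable]: "case_prod G \<in> borel_measurable (borel \<Otimes>\<^sub>M borel)" for G :: "real \<Rightarrow> real \<Rightarrow> ennreal"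
    by (intro lborel_pair.Fubini') simp
  have sheary: "(\<integral>\<^sup>+x. \<integral>\<^sup>+y. G x (r * x + y) \<partial>lborel \<partial>lborel) = (\<integral>\<^sup>+x. \<integral>\<^sup>+y. G x y \<partial>lborel \<partial>lborel)"
    if [measurable]: "case_prod G \<in> borel_measurable (borel \<Otimes>\<^sub>M borel)" for G :: "real \<Rightarrow> real \<Rightarrow> ennreal" and r
    by (intro nn_integral_cong translate) simp
  have shearx: "(\<integral>\<^sup>+x. \<integral>\<^sup>+y. G (r * y + x) y \<partial>lborel \<partial>lborel) = (\<integral>\<^sup>+x. \<integral>\<^sup>+y. G x y \<partial>lborel \<partial>lborel)"
    if [measurable]: "case_prod G \<in> borel_measurable (borel \<Otimes>\<^sub>M borel)" for G :: "real \<Rightarrow> real \<Rightarrow> ennreal" and r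
    by (subst (1 2) swap) (auto intro!: nn_integral_cong translate)
  define G1 where "G1 x y = F (- t * y + x) y" for x y
  define G2 where "G2 x y = G1 x (s * x + y)" for x y
  have m1 [measurable]: "case_prod G1 \<in> borel_measurable (borel \<Otimes>\<^sub>M borel)"
    unfolding G1_def by simp
  have m2 [measurable]: "case_prod G2 \<in> borel_measurable (borel \<Otimes>\<^sub>M borel)"
    unfolding G2_def by simp
  have eq: "F (c * x - s * y) (s * x + c * y) = G2 (- t * y + x) y" for x y
  proof -
    have a: "s * (- t * y + x) + y = s * x + c * y"
      using ts by (simp add: algebra_simps) (metis (no_types, opaque_lifting) add.commute diff_add_cancel distrib_right mult.assoc mult.commute mult_1)
    have "- t * (s * x + c * y) + (- t * y + x) = (1 - t * s) * x - (t * (1 + c)) * y"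
      by (simp add: algebra_simps)
    then have b: "- t * (s * x + c * y) + (- t * y + x) = c * x - s * y"
      by (simp add: ts tc)
    show ?thesis
      unfolding G2_def G1_def a b ..
  qed
  have "(\<integral>\<^sup>+x. \<integral>\<^sup>+y. F (c * x - s * y) (s * x + c * y) \<partial>lborel \<partial>lborel)
      = (\<integral>\<^sup>+x. \<integral>\<^sup>+y. G2 (- t * y + x) y \<partial>lborel \<partial>lborel)"
    by (simp only: eq)
  also have "\<dots> = (\<integral>\<^sup>+x. \<integral>\<^sup>+y. G2 x y \<partial>lborel \<partial>lborel)"
    by (rule shearx) simp
  also have "\<dots> = (\<integral>\<^sup>+x. \<integral>\<^sup>+y. G1 x y \<partial>lborel \<partial>lborel)"
    unfolding G2_def by (rule sheary) simp
  also have "\<dots> = (\<integral>\<^sup>+x. \<integral>\<^sup>+y. F x y \<partial>lborel \<partial>lborel)"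
    unfolding G1_def by (rule shearx) simp
  finally show ?thesis .
qed

section \<open>The product law of the data: finite boxes, independence, resampling\<close>

locale gaussian_data =
  fixes v :: real
  assumes v_pos: "v > 0"
begin

abbreviation N :: "real measure" where
  "N \<equiv> density lborel (normal_density 0 (sqrt v))"

abbreviation P :: "(nat \<times> nat \<Rightarrow> real) measure" where
  "P \<equiv> data_space v"

lemma prob_N: "prob_space N"
  using v_pos by (intro prob_space_normal_density) simp

sublocale N: prob_space N by (rule prob_N)

lemma product_N: "product_prob_space (\<lambda>_ :: nat \<times> nat. N)"
  by unfold_locales

lemma P_eq: "P = PiM UNIV (\<lambda>_. N)"
  by (simp add: data_space_def)

sublocale D: prob_space P
  unfolding P_eq by (intro prob_space_PiM prob_N)

lemma sets_P [measurable_cong]: "sets P = sets (PiM UNIV (\<lambda>_. borel))"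
  unfolding P_eq by (intro sets_PiM_cong) auto

lemma space_P [simp]: "space P = UNIV"
  by (simp add: P_eq space_PiM PiE_UNIV_domain)

lemma measurable_coord [measurable]: "(\<lambda>\<omega>. \<omega> p) \<in> borel_measurable P"
  by measurable

lemma measurable_into_P:
  assumes "\<And>i. (\<lambda>x. f x i) \<in> borel_measurable M"
  shows "f \<in> M \<rightarrow>\<^sub>M P"
proof -
  have "(\<lambda>x. \<lambda>i\<in>UNIV. f x i) \<in> M \<rightarrow>\<^sub>M PiM UNIV (\<lambda>_. borel)"
    using assms by (intro measurable_restrict) simp
  then show ?thesis
    by (simp add: measurable_cong_sets[OF refl sets_P] restrict_def)
qed

text \<open>Finite boxes determine a product measure. The invariance of the law under splicing and
  its behaviour under rescaling are both checked on such boxes.\<close>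

lemma P_eqI:
  assumes "sets Q = sets P"
    and "\<And>J F. finite J \<Longrightarrow> (\<And>j. j \<in> J \<Longrightarrow> F j \<in> sets borel) \<Longrightarrow>
      emeasure Q {\<omega>. \<forall>j\<in>J. \<omega> j \<in> F j} = (\<Prod>j\<in>J. emeasure N (F j))"
  shows "Q = P"
  unfolding P_eq
proof (rule product_prob_space.PiM_eq[OF product_N])
  show "sets Q = sets (PiM UNIV (\<lambda>_. N))"
    using assms(1) by (simp add: P_eq)
  fix J :: "(nat \<times> nat) set" and F assume *: "finite J" "\<And>j. j \<in> J \<Longrightarrow> F j \<in> sets N"
  have "prod_emb UNIV (\<lambda>_. N) J (Pi\<^sub>E J F) = {\<omega>. \<forall>j\<in>J. \<omega> j \<in> F j}"
    by (auto simp: prod_emb_def)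
  then show "emeasure Q (prod_emb UNIV (\<lambda>_. N) J (Pi\<^sub>E J F)) = (\<Prod>j\<in>J. emeasure N (F j))"
    using * assms(2)[of J F] by simp
qed

lemma emeasure_P_box:
  assumes "finite J" "\<And>j. j \<in> J \<Longrightarrow> F j \<in> sets borel"
  shows "emeasure P {\<omega>. \<forall>j\<in>J. \<omega> j \<in> F j} = (\<Prod>j\<in>J. emeasure N (F j))"
  using product_prob_space.emeasure_PiM_Collect[OF product_N, of J UNIV F] assms by (simp add: P_eq[symmetric])

lemma box_sets:
  assumes "finite J" "\<And>j. j \<in> J \<Longrightarrow> F j \<in> sets borel"
  shows "{\<omega>. \<forall>j\<in>J. \<omega> j \<in> F j} \<in> sets P"
proof -
  have "{\<omega> \<in> space P. \<omega> j \<in> F j} \<in> sets P" if "j \<in> J" for j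
    using assms(2)[OF that] by measurable
  then have "{\<omega> \<in> space P. \<forall>j\<in>J. \<omega> j \<in> F j} \<in> sets P"
    using assms(1) by (intro sets.sets_Collect_finite_All) auto
  then show ?thesis by simp
qed

text \<open>The Gaussian density is positive everywhere, so a set null for \<open>N\<close> is
  Lebesgue null, and a nonempty open set is not.\<close>

lemma emeasure_N_open_pos:
  assumes "open A" "A \<noteq> {}"
  shows "emeasure N A \<noteq> 0"
proof
  assume "emeasure N A = 0"
  then have "A \<in> null_sets N" using assms by auto
  then have "AE x in lborel. x \<in> A \<longrightarrow> ennreal (normal_density 0 (sqrt v) x) = 0"
    by (subst (asm) null_sets_density_iff) auto
  then have "AE x in lborel. x \<notin> A"
    by eventually_elim (metis ennreal_eq_0_iff normal_density_pos not_less real_sqrt_gt_zero v_pos)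
  then have "A \<in> null_sets lborel"
    using assms by (subst (asm) AE_iff_null_sets[symmetric]) auto
  then have "negligible A"
    unfolding negligible_iff_null_sets by (rule null_sets_completionI)
  then show False
    using open_not_negligible assms by blast
qed

text \<open>Every strict inequality between moments below rests on an event of positive probability,
  and this lemma supplies it.\<close>

lemma box_pos:
  assumes "finite J" "\<And>j. j \<in> J \<Longrightarrow> open (F j)" "\<And>j. j \<in> J \<Longrightarrow> F j \<noteq> {}"
  shows "emeasure P {\<omega>. \<forall>j\<in>J. \<omega> j \<in> F j} \<noteq> 0"
  using assms emeasure_N_open_pos by (subst emeasure_P_box) auto

text \<open>This is how independence is expressed: two independent samples glued along J are again
  one sample, so an integral over P splits into an integral over the coordinates in J and one over
  the rest.\<close>

definition splice :: "(nat \<times> nat) set \<Rightarrow> (nat \<times> nat \<Rightarrow> real) \<Rightarrow> (nat \<times> nat \<Rightarrow> real) \<Rightarrow> nat \<times> nat \<Rightarrow> real"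
  where "splice J \<omega> \<omega>' = (\<lambda>i. if i \<in> J then \<omega> i else \<omega>' i)"

lemma measurable_splice [measurable]:
  "(\<lambda>(\<omega>, \<omega>'). splice J \<omega> \<omega>') \<in> P \<Otimes>\<^sub>M P \<rightarrow>\<^sub>M P"
  by (rule measurable_into_P) (simp add: splice_def case_prod_beta')

lemma distr_splice: "distr (P \<Otimes>\<^sub>M P) P (\<lambda>(\<omega>, \<omega>'). splice J \<omega> \<omega>') = P"
proof (rule P_eqI)
  fix K F assume K: "finite (K :: (nat \<times> nat) set)" and F: "\<And>j. j \<in> K \<Longrightarrow> F j \<in> sets (borel :: real measure)"
  have "emeasure (distr (P \<Otimes>\<^sub>M P) P (\<lambda>(\<omega>, \<omega>'). splice J \<omega> \<omega>')) {\<omega>. \<forall>j\<in>K. \<omega> j \<in> F j}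
      = emeasure (P \<Otimes>\<^sub>M P) ({\<omega>. \<forall>j\<in>K\<inter>J. \<omega> j \<in> F j} \<times> {\<omega>. \<forall>j\<in>K-J. \<omega> j \<in> F j})"
  proof -
    have "(\<lambda>(\<omega>, \<omega>'). splice J \<omega> \<omega>') -` {\<omega>. \<forall>j\<in>K. \<omega> j \<in> F j} \<inter> space (P \<Otimes>\<^sub>M P)
      = {\<omega>. \<forall>j\<in>K\<inter>J. \<omega> j \<in> F j} \<times> {\<omega>. \<forall>j\<in>K-J. \<omega> j \<in> F j}"
      by (fastforce simp: space_pair_measure splice_def)
    then show ?thesis
      by (subst emeasure_distr[OF measurable_splice box_sets[OF K F]]) auto
  qed
  also have "\<dots> = emeasure P {\<omega>. \<forall>j\<in>K\<inter>J. \<omega> j \<in> F j} * emeasure P {\<omega>. \<forall>j\<in>K-J. \<omega> j \<in> F j}"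
    using K F by (intro D.emeasure_pair_measure_Times box_sets) auto
  also have "\<dots> = (\<Prod>j\<in>K\<inter>J. emeasure N (F j)) * (\<Prod>j\<in>K-J. emeasure N (F j))"
    using K F by (subst (1 2) emeasure_P_box) auto
  also have "\<dots> = (\<Prod>j\<in>K. emeasure N (F j))"
    using prod.Int_Diff[OF K, of "\<lambda>j. emeasure N (F j)" J] by simp
  finally show "emeasure (distr (P \<Otimes>\<^sub>M P) P (\<lambda>(\<omega>, \<omega>'). splice J \<omega> \<omega>')) {\<omega>. \<forall>j\<in>K. \<omega> j \<in> F j}
     = (\<Prod>j\<in>K. emeasure N (F j))" .
qed simp

lemma nn_integral_splice:
  assumes [measurable]: "f \<in> borel_measurable P"
  shows "(\<integral>\<^sup>+\<omega>. f \<omega> \<partial>P) = (\<integral>\<^sup>+\<omega>. \<integral>\<^sup>+\<omega>'. f (splice J \<omega> \<omega>') \<partial>P \<partial>P)"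
proof -
  have m: "(\<lambda>x. f (case x of (\<omega>, \<omega>') \<Rightarrow> splice J \<omega> \<omega>')) \<in> borel_measurable (P \<Otimes>\<^sub>M P)"
    by (rule measurable_compose[OF measurable_splice assms])
  have "(\<integral>\<^sup>+\<omega>. f \<omega> \<partial>P) = (\<integral>\<^sup>+\<omega>. f \<omega> \<partial>distr (P \<Otimes>\<^sub>M P) P (\<lambda>(\<omega>, \<omega>'). splice J \<omega> \<omega>'))"
    by (simp only: distr_splice)
  also have "\<dots> = (\<integral>\<^sup>+x. f (case x of (\<omega>, \<omega>') \<Rightarrow> splice J \<omega> \<omega>') \<partial>(P \<Otimes>\<^sub>M P))"
    by (rule nn_integral_distr[OF measurable_splice]) simp
  also have "\<dots> = (\<integral>\<^sup>+\<omega>. \<integral>\<^sup>+\<omega>'. f (splice J \<omega> \<omega>') \<partial>P \<partial>P)"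
    using D.nn_integral_fst[OF m] by simp
  finally show ?thesis .
qed

lemma distr_coord: "distr P N (\<lambda>\<omega>. \<omega> p) = N"
  using product_prob_space.PiM_component[OF product_N, of p UNIV] by (simp add: P_eq)

lemma nn_integral_coord:
  assumes [measurable]: "f \<in> borel_measurable borel"
  shows "(\<integral>\<^sup>+\<omega>. f (\<omega> p) \<partial>P) = (\<integral>\<^sup>+x. f x \<partial>N)"
proof -
  have "(\<integral>\<^sup>+x. f x \<partial>N) = (\<integral>\<^sup>+x. f x \<partial>distr P N (\<lambda>\<omega>. \<omega> p))"
    by (simp only: distr_coord)
  also have "\<dots> = (\<integral>\<^sup>+\<omega>. f (\<omega> p) \<partial>P)"
    by (rule nn_integral_distr) simp_all
  finally show ?thesis ..
qed

lemma measurable_upd [measurable]: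
  assumes "f \<in> M \<rightarrow>\<^sub>M P" "g \<in> borel_measurable M"
  shows "(\<lambda>x. (f x)(p := g x)) \<in> M \<rightarrow>\<^sub>M P"
proof -
  have f: "(\<lambda>x. f x i) \<in> borel_measurable M" for i
    using measurable_compose[OF assms(1) measurable_coord] by simp
  show ?thesis
    using f assms(2) by (intro measurable_into_P) (auto simp: fun_upd_def)
qed

text \<open>Splicing along the complement of {p}: one coordinate is integrated out while all others
  stay frozen. Rotations, products over coordinates and null-set arguments are thereby reduced to
  integrals over \<open>N\<close>.\<close>

lemma nn_integral_resample:
  assumes [measurable]: "f \<in> borel_measurable P"
  shows "(\<integral>\<^sup>+\<omega>. f \<omega> \<partial>P) = (\<integral>\<^sup>+w. \<integral>\<^sup>+x. f (w(p := x)) \<partial>N \<partial>P)"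
proof -
  have "(\<integral>\<^sup>+\<omega>. f \<omega> \<partial>P) = (\<integral>\<^sup>+\<omega>. \<integral>\<^sup>+\<omega>'. f (splice (-{p}) \<omega> \<omega>') \<partial>P \<partial>P)"
    by (rule nn_integral_splice) simp
  also have "\<dots> = (\<integral>\<^sup>+w. \<integral>\<^sup>+\<omega>'. f (w(p := \<omega>' p)) \<partial>P \<partial>P)"
    by (intro nn_integral_cong arg_cong[where f=f]) (auto simp: splice_def)
  also have "\<dots> = (\<integral>\<^sup>+w. \<integral>\<^sup>+x. f (w(p := x)) \<partial>N \<partial>P)"
    by (intro nn_integral_cong nn_integral_coord) simp
  finally show ?thesis .
qed

lemma nn_integral_reindex:
  assumes [measurable]: "f \<in> borel_measurable P" and "inj \<pi>"
  shows "(\<integral>\<^sup>+\<omega>. f (\<lambda>i. \<omega> (\<pi> i)) \<partial>P) = (\<integral>\<^sup>+\<omega>. f \<omega> \<partial>P)"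
proof -
  have eq: "distr P P (\<lambda>\<omega>. \<lambda>i. \<omega> (\<pi> i)) = P"
    using distr_PiM_reindex[of UNIV "\<lambda>_. N" \<pi> UNIV] assms(2) prob_N by (simp add: P_eq restrict_def)
  have m: "(\<lambda>\<omega>. \<lambda>i. \<omega> (\<pi> i)) \<in> P \<rightarrow>\<^sub>M P"
    by (rule measurable_into_P) simp
  have "(\<integral>\<^sup>+\<omega>. f \<omega> \<partial>P) = (\<integral>\<^sup>+\<omega>. f \<omega> \<partial>distr P P (\<lambda>\<omega>. \<lambda>i. \<omega> (\<pi> i)))"
    by (simp only: eq)
  also have "\<dots> = (\<integral>\<^sup>+\<omega>. f (\<lambda>i. \<omega> (\<pi> i)) \<partial>P)"
    by (rule nn_integral_distr[OF m]) simp
  finally show ?thesis ..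
qed

text \<open>The product of two centred densities of equal variance depends on x^2 + y^2 only, so it
  can be absorbed into the integrand of the Lebesgue version.\<close>

lemma nn_integral_rotate_N:
  fixes F :: "real \<Rightarrow> real \<Rightarrow> ennreal" and c s :: real
  assumes [measurable]: "case_prod F \<in> borel_measurable (borel \<Otimes>\<^sub>M borel)"
    and cs: "c\<^sup>2 + s\<^sup>2 = 1" and s: "s \<noteq> 0"
  shows "(\<integral>\<^sup>+x. \<integral>\<^sup>+y. F (c * x - s * y) (s * x + c * y) \<partial>N \<partial>N)
       = (\<integral>\<^sup>+x. \<integral>\<^sup>+y. F x y \<partial>N \<partial>N)"
proof -
  let ?n = "\<lambda>x. ennreal (normal_density 0 (sqrt v) x)"
  define G where "G x y = ?n x * (?n y * F x y)" for x y
  have [measurable]: "case_prod G \<in> borel_measurable (borel \<Otimes>\<^sub>M borel)"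
    unfolding G_def by measurable
  have N: "(\<integral>\<^sup>+x. \<integral>\<^sup>+y. H x y \<partial>N \<partial>N) = (\<integral>\<^sup>+x. \<integral>\<^sup>+y. ?n x * (?n y * H x y) \<partial>lborel \<partial>lborel)"
    if [measurable]: "case_prod H \<in> borel_measurable (borel \<Otimes>\<^sub>M borel)" for H :: "real \<Rightarrow> real \<Rightarrow> ennreal"
    by (simp add: nn_integral_density nn_integral_cmult)
  have inv: "?n x * ?n y = ?n (c * x - s * y) * ?n (s * x + c * y)" for x y
  proof -
    have "(c * x - s * y)\<^sup>2 + (s * x + c * y)\<^sup>2 = (c\<^sup>2 + s\<^sup>2) * (x\<^sup>2 + y\<^sup>2)"
      by (simp add: power2_eq_square algebra_simps)
    then have "(c * x - s * y)\<^sup>2 + (s * x + c * y)\<^sup>2 = x\<^sup>2 + y\<^sup>2"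
      using cs by simp
    then have "- (x\<^sup>2 / (2 * v)) - y\<^sup>2 / (2 * v) = - ((c * x - s * y)\<^sup>2 / (2 * v)) - (s * x + c * y)\<^sup>2 / (2 * v)"
      by (metis add_divide_distrib minus_add_distrib uminus_add_conv_diff add.commute)
    then have "normal_density 0 (sqrt v) x * normal_density 0 (sqrt v) y
       = normal_density 0 (sqrt v) (c * x - s * y) * normal_density 0 (sqrt v) (s * x + c * y)"
      using v_pos by (simp add: normal_density_def exp_add[symmetric] mult_exp_exp)
    then show ?thesis by (simp add: ennreal_mult'[symmetric])
  qed
  have "(\<integral>\<^sup>+x. \<integral>\<^sup>+y. F (c * x - s * y) (s * x + c * y) \<partial>N \<partial>N)
      = (\<integral>\<^sup>+x. \<integral>\<^sup>+y. G (c * x - s * y) (s * x + c * y) \<partial>lborel \<partial>lborel)"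
  proof (subst N)
    have "?n x * (?n y * F (c * x - s * y) (s * x + c * y)) = G (c * x - s * y) (s * x + c * y)" for x y
      unfolding G_def mult.assoc[symmetric] by (subst inv) (rule refl)
    then show "(\<integral>\<^sup>+x. \<integral>\<^sup>+y. ?n x * (?n y * F (c * x - s * y) (s * x + c * y)) \<partial>lborel \<partial>lborel)
      = (\<integral>\<^sup>+x. \<integral>\<^sup>+y. G (c * x - s * y) (s * x + c * y) \<partial>lborel \<partial>lborel)"
      by simp
  qed measurable
  also have "\<dots> = (\<integral>\<^sup>+x. \<integral>\<^sup>+y. G x y \<partial>lborel \<partial>lborel)"
    by (rule nn_integral_rotate_lborel) (use cs s in simp_all)
  also have "\<dots> = (\<integral>\<^sup>+x. \<integral>\<^sup>+y. F x y \<partial>N \<partial>N)"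
    unfolding G_def by (rule N[symmetric]) simp
  finally show ?thesis .
qed

end

section \<open>Rotation invariance and moments of the iterates\<close>

definition nrm :: "nat \<Rightarrow> (nat \<Rightarrow> real) \<Rightarrow> real" where
  "nrm d u = L2_set u {..<d}"

text \<open>This is I - \<kappa> * (sum of a_i a_i^T over I) applied to u, with vectors as functions
  on \<open>nat\<close> of which only the values below d matter. The set I is left free to allow
  shifted and leave-one-out batches, and \<kappa> to absorb batch size and variance.\<close>

definition step :: "real \<Rightarrow> nat set \<Rightarrow> nat \<Rightarrow> (nat \<times> nat \<Rightarrow> real) \<Rightarrow> (nat \<Rightarrow> real) \<Rightarrow> nat \<Rightarrow> real" where
  "step \<kappa> I d w u = (\<lambda>p. u p - \<kappa> * (\<Sum>i\<in>I. w (i, p) * (\<Sum>q<d. w (i, q) * u q)))"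

fun iter :: "real \<Rightarrow> nat \<Rightarrow> nat \<Rightarrow> (nat \<times> nat \<Rightarrow> real) \<Rightarrow> nat \<Rightarrow> (nat \<Rightarrow> real) \<Rightarrow> nat \<Rightarrow> real" where
  "iter \<kappa> b d w 0 u = u"
| "iter \<kappa> b d w (Suc k) u = step \<kappa> {b * k + 1 .. b * Suc k} d w (iter \<kappa> b d w k u)"

definition unit_vector :: "nat \<Rightarrow> nat \<Rightarrow> real" where
  "unit_vector j = (\<lambda>r. if r = j then 1 else 0)"

text \<open>A Givens rotation in the plane of the coordinates p and q, with cosine c and sine
  s.\<close>

definition rot :: "real \<Rightarrow> real \<Rightarrow> nat \<Rightarrow> nat \<Rightarrow> (nat \<Rightarrow> real) \<Rightarrow> nat \<Rightarrow> real" where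
  "rot c s p q u = (\<lambda>r. if r = p then c * u p - s * u q else if r = q then s * u p + c * u q else u r)"

text \<open>Only the data vectors with index in the finite set I are rotated, so that invariance of
  the law follows by induction, one row at a time.\<close>

definition rot_rows :: "real \<Rightarrow> real \<Rightarrow> nat \<Rightarrow> nat \<Rightarrow> nat set \<Rightarrow> (nat \<times> nat \<Rightarrow> real) \<Rightarrow> nat \<times> nat \<Rightarrow> real" where
  "rot_rows c s p q I w = (\<lambda>(i, r). if i \<in> I then rot c s p q (\<lambda>r. w (i, r)) r else w (i, r))"

lemma nrm_nonneg [simp]: "nrm d u \<ge> 0"
  by (simp add: nrm_def)

lemma nrm_power2: "(nrm d u)\<^sup>2 = (\<Sum>r<d. (u r)\<^sup>2)"
  by (simp add: nrm_def L2_set_def sum_nonneg)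

lemma nrm_cong: "(\<And>r. r < d \<Longrightarrow> u r = u' r) \<Longrightarrow> nrm d u = nrm d u'"
  unfolding nrm_def by (rule L2_set_cong) auto

lemma nrm_cmult: "nrm d (\<lambda>r. t * u r) = \<bar>t\<bar> * nrm d u"
proof -
  have "nrm d (\<lambda>r. t * u r) = L2_set (\<lambda>r. \<bar>t\<bar> * u r) {..<d}"
    by (simp add: nrm_def L2_set_def power_mult_distrib)
  then show ?thesis
    by (simp add: nrm_def L2_set_right_distrib)
qed

lemma nrm_uminus: "nrm d (\<lambda>r. - u r) = nrm d u"
  by (simp add: nrm_def L2_set_def)

lemma nrm_unit_vector: "j < d \<Longrightarrow> nrm d (unit_vector j) = 1"
  by (simp add: nrm_def L2_set_def unit_vector_def if_distrib[where f="\<lambda>x. x\<^sup>2"] sum.delta cong: if_cong)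

lemma step_cong:
  assumes "\<And>r. r < d \<Longrightarrow> u r = u' r" "r < d" "\<And>i r. i \<in> I \<Longrightarrow> r < d \<Longrightarrow> w (i, r) = w' (i, r)"
  shows "step \<kappa> I d w u r = step \<kappa> I d w' u' r"
  using assms by (simp add: step_def)

lemma nrm_step_cong:
  assumes "\<And>r. r < d \<Longrightarrow> u r = u' r"
  shows "nrm d (step \<kappa> I d w u) = nrm d (step \<kappa> I d w u')"
  using assms by (intro nrm_cong step_cong) auto

lemma step_cmult: "step \<kappa> I d w (\<lambda>r. t * u r) = (\<lambda>r. t * step \<kappa> I d w u r)"
  by (rule ext) (simp add: step_def algebra_simps sum_distrib_left)

lemma nrm_step_cmult: "nrm d (step \<kappa> I d w (\<lambda>r. t * u r)) = \<bar>t\<bar> * nrm d (step \<kappa> I d w u)"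
  by (simp add: step_cmult nrm_cmult)

lemma inner_rot:
  assumes pq: "p \<noteq> q" "p < d" "q < d" and cs: "c\<^sup>2 + s\<^sup>2 = 1"
  shows "(\<Sum>r<d. rot c s p q u r * rot c s p q x r) = (\<Sum>r<d. u r * x r)"
proof -
  have split: "(\<Sum>r<d. f r) = f p + (f q + (\<Sum>r\<in>{..<d} - {p} - {q}. f r))" for f :: "nat \<Rightarrow> real"
    using pq by (subst sum.remove[of _ p], simp, simp, subst sum.remove[of _ q]) auto
  have rest: "(\<Sum>r\<in>{..<d} - {p} - {q}. rot c s p q u r * rot c s p q x r) = (\<Sum>r\<in>{..<d} - {p} - {q}. u r * x r)"
    by (intro sum.cong) (auto simp: rot_def)
  have "(c * u p - s * u q) * (c * x p - s * x q) + (s * u p + c * u q) * (s * x p + c * x q)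
      = (c\<^sup>2 + s\<^sup>2) * (u p * x p + u q * x q)"
    by (simp add: power2_eq_square algebra_simps)
  then show ?thesis
    unfolding split rest using pq cs by (simp add: rot_def)
qed

lemma nrm_rot:
  assumes "p \<noteq> q" "p < d" "q < d" "c\<^sup>2 + s\<^sup>2 = 1"
  shows "nrm d (rot c s p q u) = nrm d u"
  using inner_rot[OF assms, of u u] by (simp add: nrm_def L2_set_def power2_eq_square)

text \<open>For an orthogonal Q the inner products of Q a_i with Q u equal those of a_i with u, so Q
  can be pulled out of the whole step.\<close>

lemma step_rot:
  assumes pq: "p \<noteq> q" "p < d" "q < d" and cs: "c\<^sup>2 + s\<^sup>2 = 1"
  shows "step \<kappa> I d (rot_rows c s p q I w) (rot c s p q u) = rot c s p q (step \<kappa> I d w u)"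
proof
  fix r
  let ?y = "\<lambda>i. \<Sum>r<d. w (i, r) * u r"
  have inner: "(\<Sum>r<d. rot_rows c s p q I w (i, r) * rot c s p q u r) = ?y i" if "i \<in> I" for i
    using inner_rot[OF assms, of "\<lambda>r. w (i, r)" u] that by (simp add: rot_rows_def)
  have eq: "step \<kappa> I d (rot_rows c s p q I w) (rot c s p q u) r
      = rot c s p q u r - \<kappa> * (\<Sum>i\<in>I. rot c s p q (\<lambda>r. w (i, r)) r * ?y i)"
    unfolding step_def by (simp add: inner cong: sum.cong) (simp add: rot_rows_def cong: sum.cong)
  show "step \<kappa> I d (rot_rows c s p q I w) (rot c s p q u) r = rot c s p q (step \<kappa> I d w u) r"
    unfolding eq unfolding rot_def step_def
    by (simp add: left_diff_distrib distrib_right right_diff_distrib distrib_left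
        sum.distrib sum_subtractf sum_distrib_left mult.assoc mult.left_commute)
qed

lemma rot_rows_insert:
  assumes "i \<notin> I"
  shows "rot_rows c s p q (insert i I) w = rot_rows c s p q {i} (rot_rows c s p q I w)"
  using assms by (auto simp: rot_rows_def rot_def fun_eq_iff)

text \<open>The first k steps read the rows up to b * k only. Together with splicing this makes the
  next step independent of the past.\<close>

lemma iter_cong:
  assumes "r < d" "\<And>i r. i \<le> b * k \<Longrightarrow> r < d \<Longrightarrow> w (i, r) = w' (i, r)"
  shows "iter \<kappa> b d w k u r = iter \<kappa> b d w' k u r"
  using assms
proof (induction k arbitrary: r)
  case (Suc k)
  have "b * k \<le> b * Suc k" by simp
  then show ?case
    using Suc.prems unfolding iter.simps
    by (intro step_cong Suc.IH) (auto intro: order_trans)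
qed simp

section \<open>Rotation invariance of the law of a step and the product formula\<close>

context gaussian_data
begin

lemma measurable_step [measurable]:
  assumes f [measurable]: "f \<in> M \<rightarrow>\<^sub>M P" and u [measurable]: "\<And>r. (\<lambda>x. u x r) \<in> borel_measurable M"
  shows "(\<lambda>x. step \<kappa> I d (f x) (u x) r) \<in> borel_measurable M"
proof -
  have [measurable]: "(\<lambda>x. f x i) \<in> borel_measurable M" for i
    using measurable_compose[OF f measurable_coord] by simp
  show ?thesis
    unfolding step_def by measurable
qed

lemma measurable_nrm [measurable]:
  assumes [measurable]: "\<And>r. (\<lambda>x. u x r) \<in> borel_measurable M"
  shows "(\<lambda>x. nrm d (u x)) \<in> borel_measurable M"
  unfolding nrm_def L2_set_def by measurable

lemma measurable_iter [measurable]: "(\<lambda>w. iter \<kappa> b d w k u r) \<in> borel_measurable P"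
proof (induction k arbitrary: r)
  case (Suc k)
  then show ?case unfolding iter.simps by (intro measurable_step) simp_all
qed simp

lemma measurable_rot_rows [measurable]: "rot_rows c s p q I \<in> P \<rightarrow>\<^sub>M P"
proof (rule measurable_into_P)
  fix ir :: "nat \<times> nat"
  obtain i r where ir: "ir = (i, r)" by (cases ir)
  have "(\<lambda>w. rot c s p q (\<lambda>r. w (i, r)) r) \<in> borel_measurable P"
    unfolding rot_def by measurable
  then show "(\<lambda>w. rot_rows c s p q I w ir) \<in> borel_measurable P"
    by (cases "i \<in> I") (simp_all add: rot_rows_def ir)
qed

text \<open>With all coordinates other than (i, p) and (i, q) frozen, a two-dimensional Gaussian
  integral remains, and planar rotation invariance applies to it.\<close>

lemma nn_integral_rot_row:
  assumes f [measurable]: "f \<in> borel_measurable P" and pq: "p \<noteq> q"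
    and cs: "c\<^sup>2 + s\<^sup>2 = 1" "s \<noteq> 0"
  shows "(\<integral>\<^sup>+w. f (rot_rows c s p q {i} w) \<partial>P) = (\<integral>\<^sup>+w. f w \<partial>P)"
proof -
  have resample2: "(\<integral>\<^sup>+w. g w \<partial>P) = (\<integral>\<^sup>+w. \<integral>\<^sup>+x. \<integral>\<^sup>+y. g (w((i, p) := x, (i, q) := y)) \<partial>N \<partial>N \<partial>P)"
    if [measurable]: "g \<in> borel_measurable P" for g :: "_ \<Rightarrow> ennreal"
  proof -
    have "(\<integral>\<^sup>+w. g w \<partial>P) = (\<integral>\<^sup>+w. \<integral>\<^sup>+y. g (w((i, q) := y)) \<partial>N \<partial>P)"
      by (rule nn_integral_resample) simp
    also have "\<dots> = (\<integral>\<^sup>+w. \<integral>\<^sup>+x. \<integral>\<^sup>+y. g (w((i, p) := x, (i, q) := y)) \<partial>N \<partial>N \<partial>P)"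
      by (rule nn_integral_resample) measurable
    finally show ?thesis .
  qed
  have rot: "rot_rows c s p q {i} (w((i, p) := x, (i, q) := y))
      = w((i, p) := c * x - s * y, (i, q) := s * x + c * y)" for w x y
    using pq by (auto simp: rot_rows_def rot_def fun_eq_iff)
  have "(\<integral>\<^sup>+w. f (rot_rows c s p q {i} w) \<partial>P)
      = (\<integral>\<^sup>+w. \<integral>\<^sup>+x. \<integral>\<^sup>+y. f (rot_rows c s p q {i} (w((i, p) := x, (i, q) := y))) \<partial>N \<partial>N \<partial>P)"
    by (rule resample2) measurable
  also have "\<dots> = (\<integral>\<^sup>+w. \<integral>\<^sup>+x. \<integral>\<^sup>+y. f (w((i, p) := x, (i, q) := y)) \<partial>N \<partial>N \<partial>P)"
    unfolding rot
  proof (rule nn_integral_cong)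
    fix w
    show "(\<integral>\<^sup>+x. \<integral>\<^sup>+y. f (w((i, p) := c * x - s * y, (i, q) := s * x + c * y)) \<partial>N \<partial>N)
       = (\<integral>\<^sup>+x. \<integral>\<^sup>+y. f (w((i, p) := x, (i, q) := y)) \<partial>N \<partial>N)"
      by (rule nn_integral_rotate_N[where F="\<lambda>x y. f (w((i, p) := x, (i, q) := y))"])
         (use cs in measurable)
  qed
  also have "\<dots> = (\<integral>\<^sup>+w. f w \<partial>P)"
    by (rule resample2[symmetric]) simp
  finally show ?thesis .
qed

lemma nn_integral_rot_rows:
  assumes "finite I" and f: "f \<in> borel_measurable P" and pq: "p \<noteq> q"
    and cs: "c\<^sup>2 + s\<^sup>2 = 1" "s \<noteq> 0"
  shows "(\<integral>\<^sup>+w. f (rot_rows c s p q I w) \<partial>P) = (\<integral>\<^sup>+w. f w \<partial>P)"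
  using assms(1,2)
proof (induction I arbitrary: f)
  case empty
  then show ?case by (simp add: rot_rows_def)
next
  case (insert i I)
  note [measurable] = insert.prems
  have "(\<integral>\<^sup>+w. f (rot_rows c s p q (insert i I) w) \<partial>P)
      = (\<integral>\<^sup>+w. f (rot_rows c s p q {i} (rot_rows c s p q I w)) \<partial>P)"
    by (simp only: rot_rows_insert[OF insert.hyps(2)])
  also have "\<dots> = (\<integral>\<^sup>+w. f (rot_rows c s p q {i} w) \<partial>P)"
    by (rule insert.IH) measurable
  also have "\<dots> = (\<integral>\<^sup>+w. f w \<partial>P)"
    by (rule nn_integral_rot_row[OF insert.prems pq cs])
  finally show ?case .
qed

text \<open>Replacing the data by rotated data leaves the law unchanged; then data and vector are
  rotated alike, the rotation leaves the step, and the norm does not see it.\<close>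

lemma nn_integral_step_rot:
  assumes "finite I" and [measurable]: "f \<in> borel_measurable borel" and pq: "p \<noteq> q" "p < d" "q < d"
    and cs: "c\<^sup>2 + s\<^sup>2 = 1" "s \<noteq> 0"
  shows "(\<integral>\<^sup>+w. f (nrm d (step \<kappa> I d w (rot c s p q u))) \<partial>P) = (\<integral>\<^sup>+w. f (nrm d (step \<kappa> I d w u)) \<partial>P)"
proof -
  have "(\<integral>\<^sup>+w. f (nrm d (step \<kappa> I d w (rot c s p q u))) \<partial>P)
      = (\<integral>\<^sup>+w. f (nrm d (step \<kappa> I d (rot_rows c s p q I w) (rot c s p q u))) \<partial>P)"
    by (rule nn_integral_rot_rows[OF assms(1) _ pq(1) cs, symmetric]) measurable
  also have "\<dots> = (\<integral>\<^sup>+w. f (nrm d (step \<kappa> I d w u)) \<partial>P)"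
    by (simp only: step_rot[OF pq cs(1)] nrm_rot[OF pq cs(1)])
  finally show ?thesis .
qed

text \<open>A Givens rotation in the coordinates 0 and n kills the n-th coordinate of u without
  changing the law of the step, so u can be moved onto the first axis.\<close>

lemma nn_integral_step_invariant:
  assumes I: "finite I" and d: "d \<ge> 1" and f [measurable]: "f \<in> borel_measurable borel"
  shows "(\<integral>\<^sup>+w. f (nrm d (step \<kappa> I d w u)) \<partial>P)
       = (\<integral>\<^sup>+w. f (nrm d u * nrm d (step \<kappa> I d w (unit_vector 0))) \<partial>P)"
proof -
  \<comment> \<open>n bounds the number of leading coordinates of u that may be nonzero; at n = 1
    the vector is a multiple of the first unit vector and homogeneity finishes.\<close>
  have *: "(\<integral>\<^sup>+w. f (nrm d (step \<kappa> I d w u)) \<partial>P)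
       = (\<integral>\<^sup>+w. f (nrm d u * nrm d (step \<kappa> I d w (unit_vector 0))) \<partial>P)"
    if "1 \<le> n" "\<And>r. n \<le> r \<Longrightarrow> r < d \<Longrightarrow> u r = 0" for n and u :: "nat \<Rightarrow> real"
    using that
  proof (induction n arbitrary: u rule: nat_induct_at_least)
    case base
    have u: "u r = u 0 * unit_vector 0 r" if "r < d" for r
      using base[of r] that by (cases "r = 0") (auto simp: unit_vector_def)
    have "nrm d u = \<bar>u 0\<bar>"
      using d nrm_cong[of d u, OF u] nrm_unit_vector[of 0 d] by (simp add: nrm_cmult)
    moreover have "nrm d (step \<kappa> I d w u) = \<bar>u 0\<bar> * nrm d (step \<kappa> I d w (unit_vector 0))" for w
      using nrm_step_cong[of d u, OF u] nrm_step_cmult by simp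
    ultimately show ?case by simp
  next
    case (Suc n)
    show ?case
    proof (cases "n < d \<and> u n \<noteq> 0")
      case False
      then have "u r = 0" if "n \<le> r" "r < d" for r
        using that Suc.prems[of r] by (cases "r = n") auto
      then show ?thesis by (rule Suc.IH)
    next
      case True
      define \<rho> where "\<rho> = sqrt ((u 0)\<^sup>2 + (u n)\<^sup>2)"
      define c where "c = u 0 / \<rho>"
      \<comment> \<open>The sign is chosen so that the rotated coordinate n, which is s * u 0 + c *
        u n, vanishes.\<close>
      define s where "s = - u n / \<rho>"
      have pos: "(u 0)\<^sup>2 + (u n)\<^sup>2 > 0" using True by (simp add: add_nonneg_pos)
      then have \<rho>: "\<rho> > 0" "\<rho>\<^sup>2 = (u 0)\<^sup>2 + (u n)\<^sup>2" by (simp_all add: \<rho>_def)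
      have cs: "c\<^sup>2 + s\<^sup>2 = 1"
        using \<rho> pos True by (simp add: c_def s_def power_divide add_divide_distrib[symmetric])
      have s: "s \<noteq> 0" using True \<rho> by (simp add: s_def)
      have pq: "0 \<noteq> n" "0 < d" "n < d" using True d Suc.hyps by auto
      have "s * u 0 + c * u n = 0" by (simp add: s_def c_def)
      then have zero: "rot c s 0 n u r = 0" if "n \<le> r" "r < d" for r
        using that pq Suc.prems[of r] by (auto simp: rot_def)
      have "(\<integral>\<^sup>+w. f (nrm d (step \<kappa> I d w u)) \<partial>P) = (\<integral>\<^sup>+w. f (nrm d (step \<kappa> I d w (rot c s 0 n u))) \<partial>P)"
        by (rule nn_integral_step_rot[OF I f pq cs s, symmetric])
      also have "\<dots> = (\<integral>\<^sup>+w. f (nrm d (rot c s 0 n u) * nrm d (step \<kappa> I d w (unit_vector 0))) \<partial>P)"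
        by (rule Suc.IH) (rule zero)
      finally show ?thesis
        by (simp only: nrm_rot[OF pq cs])
    qed
  qed
  show ?thesis
    by (rule *[of d]) (use d in auto)
qed

definition moment :: "real \<Rightarrow> nat set \<Rightarrow> nat \<Rightarrow> real \<Rightarrow> ennreal" where
  "moment \<kappa> I d s = (\<integral>\<^sup>+w. ennreal (nrm d (step \<kappa> I d w (unit_vector 0)) powr s) \<partial>P)"

lemma nn_integral_step_powr:
  assumes "finite I" "d \<ge> 1"
  shows "(\<integral>\<^sup>+w. ennreal (nrm d (step \<kappa> I d w u) powr s) \<partial>P) = ennreal (nrm d u powr s) * moment \<kappa> I d s"
proof -
  have "(\<integral>\<^sup>+w. ennreal (nrm d (step \<kappa> I d w u) powr s) \<partial>P)
      = (\<integral>\<^sup>+w. ennreal ((nrm d u * nrm d (step \<kappa> I d w (unit_vector 0))) powr s) \<partial>P)"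
    by (rule nn_integral_step_invariant[OF assms]) measurable
  also have "\<dots> = (\<integral>\<^sup>+w. ennreal (nrm d u powr s) * ennreal (nrm d (step \<kappa> I d w (unit_vector 0)) powr s) \<partial>P)"
    by (simp add: powr_mult ennreal_mult')
  also have "\<dots> = ennreal (nrm d u powr s) * moment \<kappa> I d s"
    unfolding moment_def by (rule nn_integral_cmult) measurable
  finally show ?thesis .
qed

text \<open>The data vectors are i.i.d., so a batch may be relabelled. This serves to shift the k-th
  batch to the first one and to compare leave-one-out batches.\<close>

lemma moment_reindex:
  assumes \<pi>: "inj \<pi>"
  shows "moment \<kappa> (\<pi> ` I) d s = moment \<kappa> I d s"
proof -
  let ?f = "\<lambda>(i, r). (\<pi> i, r :: nat)"
  have inj: "inj ?f" using \<pi> by (auto simp: inj_on_def)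
  have eq: "step \<kappa> (\<pi> ` I) d w u = step \<kappa> I d (\<lambda>i. w (?f i)) u" for w u
    using \<pi> by (auto simp: step_def sum.reindex inj_on_subset)
  have "moment \<kappa> (\<pi> ` I) d s
      = (\<integral>\<^sup>+w. ennreal (nrm d (step \<kappa> I d (\<lambda>i. w (?f i)) (unit_vector 0)) powr s) \<partial>P)"
    unfolding moment_def eq ..
  also have "\<dots> = moment \<kappa> I d s"
    unfolding moment_def by (rule nn_integral_reindex[OF _ inj]) measurable
  finally show ?thesis .
qed

text \<open>The identity holds for every real s, also negative, because 0 powr s = 0.\<close>

lemma nn_integral_iter_powr:
  assumes d: "d \<ge> 1"
  shows "(\<integral>\<^sup>+w. ennreal (nrm d (iter \<kappa> b d w k u) powr s) \<partial>P)
       = ennreal (nrm d u powr s) * moment \<kappa> {1..b} d s ^ k"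
proof (induction k)
  case 0
  then show ?case by (simp add: D.emeasure_space_1[simplified])
next
  case (Suc k)
  define J :: "(nat \<times> nat) set" where "J = {..b * k} \<times> UNIV"
  let ?I = "{b * k + 1 .. b * Suc k}"
  let ?m = "moment \<kappa> {1..b} d s"
  have "?I = (\<lambda>i. i + b * k) ` {1..b}"
    by (simp add: add.commute)
  then have m: "moment \<kappa> ?I d s = ?m"
    by (simp only:) (rule moment_reindex, simp)
  have spl: "nrm d (iter \<kappa> b d (splice J w w') (Suc k) u) = nrm d (step \<kappa> ?I d w' (iter \<kappa> b d w k u))" for w w'
    unfolding iter.simps
    by (intro nrm_cong step_cong iter_cong) (auto simp: splice_def J_def)
  have "(\<integral>\<^sup>+w. ennreal (nrm d (iter \<kappa> b d w (Suc k) u) powr s) \<partial>P)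
      = (\<integral>\<^sup>+w. \<integral>\<^sup>+w'. ennreal (nrm d (iter \<kappa> b d (splice J w w') (Suc k) u) powr s) \<partial>P \<partial>P)"
    by (rule nn_integral_splice) measurable
  also have "\<dots> = (\<integral>\<^sup>+w. ennreal (nrm d (iter \<kappa> b d w k u) powr s) * ?m \<partial>P)"
    unfolding spl by (subst nn_integral_step_powr) (use d m in auto)
  also have "\<dots> = (\<integral>\<^sup>+w. ennreal (nrm d (iter \<kappa> b d w k u) powr s) \<partial>P) * ?m"
    by (rule nn_integral_multc) measurable
  finally show ?case
    by (simp add: Suc.IH mult.left_commute mult.commute)
qed

end

section \<open>Moment functions of positive random variables\<close>

text \<open>The inequality 1 + u < exp u is used at (1 - t) * y and - t * y, whose mean with weights
  t and 1 - t is 0; multiplying by exp (t * y) gives the claim.\<close>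

lemma exp_convex_strict:
  fixes y t :: real
  assumes "0 < t" "t < 1" "y \<noteq> 0"
  shows "exp (t * y) < t * exp y + (1 - t)"
proof -
  have strict: "1 + u < exp u" if "u \<noteq> 0" for u :: real
  proof -
    have "exp u \<noteq> 1 + u"
      using ln_eq_minus_one[of "exp u"] that by auto
    then show ?thesis
      using exp_ge_add_one_self[of u] by linarith
  qed
  have "1 = t * (1 + (1 - t) * y) + (1 - t) * (1 + (- t * y))"
    by (simp add: algebra_simps)
  also have "\<dots> < t * exp ((1 - t) * y) + (1 - t) * exp (- t * y)"
    using assms by (intro add_strict_mono mult_strict_left_mono strict) auto
  finally have "exp (t * y) * 1 < exp (t * y) * (t * exp ((1 - t) * y) + (1 - t) * exp (- t * y))"
    by (rule mult_strict_left_mono) simp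
  also have "\<dots> = t * exp y + (1 - t)"
    by (simp add: distrib_left mult.left_commute exp_add[symmetric] algebra_simps)
  finally show ?thesis by simp
qed

lemma exp_convex_le:
  fixes y t :: real
  assumes "0 \<le> t" "t \<le> 1"
  shows "exp (t * y) \<le> t * exp y + (1 - t)"
  using exp_convex_strict[of t y] assms by (cases "t = 0 \<or> t = 1 \<or> y = 0") auto

text \<open>The derivative of exp (y * s) at s = 0 along s = 1 / (n + 2). The offset 2 keeps s
  strictly between 0 and 1, where convexity will bound the quotients.\<close>

lemma exp_difference_quotient:
  fixes y :: real
  shows "(\<lambda>n. (exp (y / (real n + 2)) - 1) * (real n + 2)) \<longlonglongrightarrow> y"
proof -
  have "((\<lambda>s. exp (y * s)) has_real_derivative y) (at 0)"
    by (auto intro!: derivative_eq_intros)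
  then have "((\<lambda>s. (exp (y * s) - 1) / s) \<longlongrightarrow> y) (at 0)"
    by (simp add: has_field_derivative_iff)
  moreover have "filterlim (\<lambda>n. 1 / (real n + 2)) (at 0) sequentially"
    by (intro filterlim_atI tendsto_divide_0[OF tendsto_const])
       (auto intro!: filterlim_at_top_imp_at_infinity filterlim_tendsto_add_at_top filterlim_real_sequentially
         simp: add.commute[of _ 2] add_nonneg_eq_0_iff)
  ultimately have "((\<lambda>n. (exp (y * (1 / (real n + 2))) - 1) / (1 / (real n + 2))) \<longlongrightarrow> y) sequentially"
    by (rule filterlim_compose)
  then show ?thesis by simp
qed

text \<open>The difference quotients of E exp (s Y) at s = 0 lie between Y and exp Y pointwise, so
  dominated convergence yields the slope E Y. For small s this gives E exp (s Y) < 1 + s (E Y +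
  \<epsilon>), and 1 + x <= exp x turns it into a Chernoff exponent.\<close>

lemma (in prob_space) expectation_exp_less:
  fixes Y :: "'a \<Rightarrow> real"
  assumes Y: "integrable M Y" and eY: "integrable M (\<lambda>x. exp (Y x))" and "\<epsilon> > 0"
  shows "\<exists>s. 0 < s \<and> s < 1 \<and> expectation (\<lambda>x. exp (s * Y x)) < exp (s * (expectation Y + \<epsilon>))"
proof -
  have [measurable]: "Y \<in> borel_measurable M" using Y by auto
  define F where "F n x = (exp (Y x / (real n + 2)) - 1) * (real n + 2)" for n :: nat and x
  have lower: "Y x \<le> F n x" for n x
    using exp_ge_add_one_self[of "Y x / (real n + 2)"] by (simp add: F_def field_simps)
  have upper: "F n x \<le> exp (Y x)" for n x
  proof -
    define m where "m = real n + 2"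
    have m: "m > 0" by (simp add: m_def)
    have "exp (Y x / m) - 1 \<le> (exp (Y x) - 1) / m"
      using exp_convex_le[of "1 / m" "Y x"] by (simp add: m_def diff_divide_distrib)
    then have "F n x \<le> exp (Y x) - 1"
      using m unfolding F_def m_def[symmetric] by (simp add: pos_le_divide_eq)
    then show ?thesis by simp
  qed
  have "(\<lambda>n. expectation (F n)) \<longlonglongrightarrow> expectation Y"
  proof (rule integral_dominated_convergence)
    show "integrable M (\<lambda>x. \<bar>Y x\<bar> + exp (Y x))" using Y eY by auto
    show "AE x in M. (\<lambda>n. F n x) \<longlonglongrightarrow> Y x"
      unfolding F_def by (intro AE_I2 exp_difference_quotient)
    show "AE x in M. norm (F n x) \<le> \<bar>Y x\<bar> + exp (Y x)" for n
    proof (intro AE_I2)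
      fix x
      show "norm (F n x) \<le> \<bar>Y x\<bar> + exp (Y x)"
        using lower[of x n] upper[of n x] exp_gt_zero[of "Y x"] unfolding real_norm_def by linarith
    qed
  qed (unfold F_def, measurable)
  then have "\<forall>\<^sub>F n in sequentially. expectation (F n) < expectation Y + \<epsilon>"
    using \<open>\<epsilon> > 0\<close> by (intro order_tendstoD) auto
  then obtain n where n: "expectation (F n) < expectation Y + \<epsilon>"
    by (auto simp: eventually_sequentially)
  define s where "s = 1 / (real n + 2)"
  have s: "0 < s" "s < 1" by (auto simp: s_def)
  have "integrable M (\<lambda>x. exp (s * Y x))"
  proof (rule Bochner_Integration.integrable_bound)
    show "integrable M (\<lambda>x. s * exp (Y x) + (1 - s))" using eY by auto
    show "AE x in M. norm (exp (s * Y x)) \<le> norm (s * exp (Y x) + (1 - s))"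
      using s exp_convex_le[of s] by (intro AE_I2) (auto intro: order_trans[OF _ abs_ge_self])
  qed simp
  then have "expectation (F n) = (expectation (\<lambda>x. exp (s * Y x)) - 1) / s"
    by (simp add: F_def[abs_def] s_def prob_space)
  then have "expectation (\<lambda>x. exp (s * Y x)) < 1 + s * (expectation Y + \<epsilon>)"
    using mult_strict_left_mono[OF n s(1)] s by simp
  also have "\<dots> \<le> exp (s * (expectation Y + \<epsilon>))"
    by (rule exp_ge_add_one_self)
  finally show ?thesis using s by blast
qed

text \<open>Collects what is used of |M_1 e_1|. The range down to -1/4 leaves room for the negative
  exponents of the lower Chernoff bound. The event R > 2 excludes R = 1, which gives strict
  convexity, and drives g above 1 for large exponents.\<close>

locale positive_rv = prob_space +
  fixes R :: "'a \<Rightarrow> real"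
  assumes R_measurable [measurable]: "R \<in> borel_measurable M"
    and R_pos: "AE x in M. R x > 0"
    and R_integrable: "s \<ge> - (1/4) \<Longrightarrow> integrable M (\<lambda>x. R x powr s)"
    and R_large: "emeasure M {x \<in> space M. R x > 2} \<noteq> 0"
begin

definition g :: "real \<Rightarrow> real" where
  "g s = expectation (\<lambda>x. R x powr s)"

definition \<gamma> :: real where
  "\<gamma> = expectation (\<lambda>x. ln (R x))"

lemma AE_powr: "AE x in M. R x powr s = exp (s * ln (R x))"
  using R_pos by eventually_elim (simp add: powr_def)

lemma g_exp: "g s = expectation (\<lambda>x. exp (s * ln (R x)))"
  unfolding g_def using AE_powr by (intro integral_cong_AE) auto

lemma integrable_exp_ln: "s \<ge> - (1/4) \<Longrightarrow> integrable M (\<lambda>x. exp (s * ln (R x)))"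
  using R_integrable[of s] AE_powr[of s] by (subst integrable_cong_AE[symmetric]) auto

text \<open>From 1 + y <= exp y at y = ln R and at y = - ln R / 4: the logarithm is bounded above by
  the first moment term and below by minus four times the term of exponent -1/4.\<close>

lemma integrable_ln_R: "integrable M (\<lambda>x. ln (R x))"
proof (rule Bochner_Integration.integrable_bound)
  show "integrable M (\<lambda>x. exp (1 * ln (R x)) + 4 * exp (- (1/4) * ln (R x)))"
    using integrable_exp_ln[of 1] integrable_exp_ln[of "-(1/4)"] by auto
  show "AE x in M. norm (ln (R x)) \<le> norm (exp (1 * ln (R x)) + 4 * exp (- (1/4) * ln (R x)))"
  proof (intro AE_I2)
    fix x
    have "ln (R x) \<le> exp (1 * ln (R x))" "- ln (R x) \<le> 4 * exp (- (1/4) * ln (R x))"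
      using exp_ge_add_one_self[of "ln (R x)"] exp_ge_add_one_self[of "- (1/4) * ln (R x)"]
      unfolding mult_1 by linarith+
    moreover have "exp (1 * ln (R x)) > 0" "exp (- (1/4) * ln (R x)) > 0" by simp_all
    ultimately show "norm (ln (R x)) \<le> norm (exp (1 * ln (R x)) + 4 * exp (- (1/4) * ln (R x)))"
      unfolding real_norm_def by linarith
  qed
qed simp

lemma g_upper: "\<epsilon> > 0 \<Longrightarrow> \<exists>s. 0 < s \<and> g s < exp (s * (\<gamma> + \<epsilon>))"
  using expectation_exp_less[OF integrable_ln_R, of \<epsilon>] integrable_exp_ln[of 1]
  by (auto simp: g_exp \<gamma>_def)

text \<open>The Chernoff bound is applied to - ln R / 4, since only the exponents down to -1/4 are
  known to be integrable; its parameter s in (0, 1) becomes the exponent - s / 4.\<close>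

lemma g_lower:
  assumes "\<epsilon> > 0"
  shows "\<exists>s. 0 < s \<and> s \<le> 1/4 \<and> g (- s) < exp (- s * (\<gamma> - \<epsilon>))"
proof -
  obtain s where s: "0 < s" "s < 1"
    "expectation (\<lambda>x. exp (s * (- (1/4) * ln (R x)))) < exp (s * (expectation (\<lambda>x. - (1/4) * ln (R x)) + \<epsilon> / 4))"
    using expectation_exp_less[of "\<lambda>x. - (1/4) * ln (R x)" "\<epsilon> / 4"] integrable_ln_R integrable_exp_ln[of "-(1/4)"] assms
    by auto
  have "g (- (s/4)) < exp (s * (- (1/4) * \<gamma> + \<epsilon> / 4))"
    using s(3) by (simp add: g_exp \<gamma>_def)
  also have "s * (- (1/4) * \<gamma> + \<epsilon> / 4) = - (s/4) * (\<gamma> - \<epsilon>)"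
    by (simp add: field_simps)
  finally show ?thesis using s(1,2) by (intro exI[of _ "s/4"]) auto
qed

text \<open>The chord of g from 0, where its value is 1, to t. Strictness comes from the event R >
  2, on which ln R is nonzero.\<close>

lemma g_less_interpolation:
  assumes "0 < s" "s < t"
  shows "g s < s / t * g t + (1 - s / t)"
proof -
  have t: "0 < s / t" "s / t < 1" using assms by auto
  have eq: "s * y = s / t * (t * y)" for y using assms by simp
  have "g s < expectation (\<lambda>x. s / t * exp (t * ln (R x)) + (1 - s / t))"
    unfolding g_exp
  proof (rule integral_less_AE)
    show "integrable M (\<lambda>x. exp (s * ln (R x)))" "integrable M (\<lambda>x. s / t * exp (t * ln (R x)) + (1 - s / t))"
      using integrable_exp_ln[of s] integrable_exp_ln[of t] assms by auto
    show "emeasure M {x \<in> space M. R x > 2} \<noteq> 0" by (rule R_large)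
    show "AE x in M. x \<in> {x \<in> space M. R x > 2} \<longrightarrow> exp (s * ln (R x)) \<noteq> s / t * exp (t * ln (R x)) + (1 - s / t)"
    proof (intro AE_I2 impI)
      fix x assume "x \<in> {x \<in> space M. R x > 2}"
      then have "ln (R x) \<noteq> 0" by auto
      then show "exp (s * ln (R x)) \<noteq> s / t * exp (t * ln (R x)) + (1 - s / t)"
        using exp_convex_strict[OF t, of "t * ln (R x)"] assms unfolding eq[symmetric] by auto
    qed
    show "AE x in M. exp (s * ln (R x)) \<le> s / t * exp (t * ln (R x)) + (1 - s / t)"
      using exp_convex_le[of "s / t" "t * ln (R x)" for x] t unfolding eq[symmetric] by auto
  qed measurable
  also have "\<dots> = s / t * g t + (1 - s / t)"
    using integrable_exp_ln[of t] assms by (simp add: g_exp prob_space)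
  finally show ?thesis .
qed

lemma g_less_1: "0 < s \<Longrightarrow> s < t \<Longrightarrow> g t \<le> 1 \<Longrightarrow> g s < 1"
proof -
  assume a: "0 < s" "s < t" "g t \<le> 1"
  have "s / t * g t \<le> s / t * 1" using a by (intro mult_left_mono) auto
  then show "g s < 1" using g_less_interpolation[OF a(1,2)] by linarith
qed

lemma continuous_on_g: "continuous_on {- (1/4)<..} g"
proof (rule convex_on_continuous)
  show "convex_on {- (1/4)<..} g"
  proof (rule convex_onI)
    fix t x y :: real assume a: "0 < t" "t < 1" "x \<in> {- (1/4)<..}" "y \<in> {- (1/4)<..}"
    have xy: "- (1/4) \<le> (1 - t) * x + t * y"
      using a mult_left_mono[of "-(1/4)" x "1 - t"] mult_left_mono[of "-(1/4)" y t]
      by (simp add: diff_divide_distrib)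
    have "g ((1 - t) * x + t * y) \<le> expectation (\<lambda>w. (1 - t) * exp (x * ln (R w)) + t * exp (y * ln (R w)))"
      unfolding g_exp
    proof (rule integral_mono)
      show "integrable M (\<lambda>w. exp (((1 - t) * x + t * y) * ln (R w)))"
        by (rule integrable_exp_ln[OF xy])
      show "integrable M (\<lambda>w. (1 - t) * exp (x * ln (R w)) + t * exp (y * ln (R w)))"
        using a integrable_exp_ln[of x] integrable_exp_ln[of y] by auto
      show "exp (((1 - t) * x + t * y) * ln (R w)) \<le> (1 - t) * exp (x * ln (R w)) + t * exp (y * ln (R w))" for w
        using convex_onD[OF exp_convex, of t "x * ln (R w)" "y * ln (R w)"] a
        by (simp add: algebra_simps)
    qed
    also have "\<dots> = (1 - t) * g x + t * g y"
      using a integrable_exp_ln[of x] integrable_exp_ln[of y] by (simp add: g_exp)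
    finally show "g ((1 - t) *\<^sub>R x + t *\<^sub>R y) \<le> (1 - t) * g x + t * g y" by simp
  qed simp
qed simp

text \<open>The event R > 2 alone contributes at least 2^n times its probability to the n-th
  moment.\<close>

lemma ex_g_gt_1: "\<exists>s>0. g s > 1"
proof -
  define A where "A = {x \<in> space M. R x > 2}"
  have A [measurable]: "A \<in> sets M" by (simp add: A_def)
  have p: "prob A > 0"
    using R_large by (simp add: A_def emeasure_eq_measure zero_less_measure_iff)
  obtain n where n: "1 / prob A < 2 ^ n" "n > 0"
    using real_arch_pow[of 2 "1 / prob A"] by (metis gr0I less_trans one_less_numeral_iff power_0 power_one_right semiring_norm(76))
  have "1 < prob A * 2 ^ n" using n p by (simp add: field_simps)
  also have "\<dots> = expectation (\<lambda>x. 2 ^ n * indicator A x)" by simp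
  also have "\<dots> \<le> g n"
    unfolding g_def
  proof (rule integral_mono)
    show "2 ^ n * indicator A x \<le> R x powr n" for x
      using powr_mono2[of n 2 "R x"] by (auto simp: A_def indicator_def powr_realpow)
    show "integrable M (\<lambda>x. 2 ^ n * indicator A x :: real)"
      by (intro integrable_mult_right integrable_real_indicator) (auto simp: emeasure_eq_measure)
  qed (use R_integrable[of n] in auto)
  finally show ?thesis using n by (intro exI[of _ "real n"]) auto
qed

lemma ex1_root:
  assumes "\<gamma> < 0"
  shows "\<exists>!\<alpha>. \<alpha> > 0 \<and> g \<alpha> = 1"
proof (rule ex_ex1I)
  \<comment> \<open>With \<epsilon> = - \<gamma> the bound on the right is exp 0 = 1, so g is below
    1 at some positive s.\<close>
  obtain s where s: "0 < s" "g s < exp (s * (\<gamma> + - \<gamma>))"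
    using g_upper[of "- \<gamma>"] assms by auto
  obtain t where t: "0 < t" "g t > 1" using ex_g_gt_1 by blast
  have "s < t" using g_less_1[of t s] s t by (cases s t rule: linorder_cases) auto
  moreover have "continuous_on {s..t} g"
    using s by (intro continuous_on_subset[OF continuous_on_g]) auto
  ultimately obtain x where "s \<le> x" "x \<le> t" "g x = 1"
    using IVT'[of g s 1 t] s t by auto
  then show "\<exists>\<alpha>. \<alpha> > 0 \<and> g \<alpha> = 1" using s by (intro exI[of _ x]) auto
next
  fix x y assume "x > 0 \<and> g x = 1" "y > 0 \<and> g y = 1"
  then show "x = y"
    using g_less_1[of x y] g_less_1[of y x] by (cases x y rule: linorder_cases) auto
qed

text \<open>The sign of g - 1 at one point locates that point relative to the root. So the
  tail-index of one parameter set can be tested in the moment function of another.\<close>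

lemma less_root: "\<alpha> > 0 \<Longrightarrow> g \<alpha> = 1 \<Longrightarrow> s > 0 \<Longrightarrow> g s < 1 \<Longrightarrow> s < \<alpha>"
  using g_less_1[of \<alpha> s] by (cases s \<alpha> rule: linorder_cases) auto

lemma root_less: "\<alpha> > 0 \<Longrightarrow> g \<alpha> = 1 \<Longrightarrow> s > 0 \<Longrightarrow> g s > 1 \<Longrightarrow> \<alpha> < s"
  using g_less_1[of s \<alpha>] by (cases s \<alpha> rule: linorder_cases) auto

end

section \<open>Spectral norm and largest eigenvalue\<close>

text \<open>The Frobenius norm. It shows that the supremum in \<open>spec_norm\<close> is finite
  and, being a sum over columns, bounds it by the images of the unit vectors.\<close>

definition fro :: "nat \<Rightarrow> real mat \<Rightarrow> real" where
  "fro d A = sqrt (\<Sum>p<d. \<Sum>q<d. (A $$ (p, q))\<^sup>2)"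

lemma fro_nonneg [simp]: "fro d A \<ge> 0"
  by (simp add: fro_def sum_nonneg)

lemma fro_power2: "(fro d A)\<^sup>2 = (\<Sum>p<d. \<Sum>q<d. (A $$ (p, q))\<^sup>2)"
  by (simp add: fro_def sum_nonneg)

lemma vnorm_nonneg [simp]: "vnorm x \<ge> 0"
  by (simp add: vnorm_def scalar_prod_def sum_nonneg)

lemma vnorm_power2: "(vnorm x)\<^sup>2 = x \<bullet> x"
  by (simp add: vnorm_def scalar_prod_def sum_nonneg)

lemma vnorm_power2_sum: "x \<in> carrier_vec d \<Longrightarrow> (vnorm x)\<^sup>2 = (\<Sum>p<d. (x $ p)\<^sup>2)"
  by (simp only: vnorm_power2) (simp add: scalar_prod_def power2_eq_square lessThan_atLeast0)

lemma vnorm_vec: "vnorm (vec d u) = nrm d u"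
  by (simp add: vnorm_def nrm_def L2_set_def scalar_prod_def power2_eq_square lessThan_atLeast0)

lemma vnorm_smult: "vnorm (t \<cdot>\<^sub>v x) = \<bar>t\<bar> * vnorm x"
proof -
  have "vnorm (t \<cdot>\<^sub>v x) = sqrt (t\<^sup>2 * (x \<bullet> x))"
    by (simp add: vnorm_def scalar_prod_def sum_distrib_left power2_eq_square ac_simps)
  then show ?thesis by (simp add: vnorm_def real_sqrt_mult)
qed

lemma vnorm_eq_0: "x \<in> carrier_vec d \<Longrightarrow> vnorm x = 0 \<Longrightarrow> x = 0\<^sub>v d"
  using vnorm_power2_sum[of x d] by (auto simp: sum_nonneg_eq_0_iff intro!: eq_vecI)

lemma vnorm_mult_le:
  assumes A: "A \<in> carrier_mat d d" and x: "x \<in> carrier_vec d"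
  shows "vnorm (A *\<^sub>v x) \<le> fro d A * vnorm x"
proof (rule power2_le_imp_le)
  have "(vnorm (A *\<^sub>v x))\<^sup>2 = (\<Sum>p<d. (\<Sum>q<d. A $$ (p, q) * x $ q)\<^sup>2)"
    using A x by (subst vnorm_power2_sum[of _ d]) (auto simp: scalar_prod_def lessThan_atLeast0 intro!: sum.cong)
  also have "\<dots> \<le> (\<Sum>p<d. (\<Sum>q<d. (A $$ (p, q))\<^sup>2) * (\<Sum>q<d. (x $ q)\<^sup>2))"
    by (intro sum_mono Cauchy_Schwarz_ineq_sum)
  also have "\<dots> = (fro d A * vnorm x)\<^sup>2"
    using x by (simp add: power_mult_distrib fro_power2 vnorm_power2_sum sum_distrib_right)
  finally show "(vnorm (A *\<^sub>v x))\<^sup>2 \<le> (fro d A * vnorm x)\<^sup>2" .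
qed simp

lemma fro_columns:
  assumes A: "A \<in> carrier_mat d d"
  shows "(fro d A)\<^sup>2 = (\<Sum>j<d. (vnorm (A *\<^sub>v unit_vec d j))\<^sup>2)"
proof -
  have "(vnorm (A *\<^sub>v unit_vec d j))\<^sup>2 = (\<Sum>p<d. (A $$ (p, j))\<^sup>2)" if "j < d" for j
    using A that by (subst vnorm_power2_sum[of _ d]) (auto intro!: sum.cong)
  then show ?thesis
    unfolding fro_power2 by (subst sum.swap) simp
qed

lemma spec_norm_bdd:
  assumes A: "A \<in> carrier_mat d d"
  shows "bdd_above {vnorm (A *\<^sub>v x) | x. x \<in> carrier_vec d \<and> vnorm x = 1}"
  using vnorm_mult_le[OF A] by (intro bdd_aboveI[of _ "fro d A"]) force

lemma vnorm_unit_vec: "j < d \<Longrightarrow> vnorm (unit_vec d j) = 1"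
  by (simp add: vnorm_def)

lemma spec_norm_upper:
  assumes A: "A \<in> carrier_mat d d" and x: "x \<in> carrier_vec d"
  shows "vnorm (A *\<^sub>v x) \<le> spec_norm d A * vnorm x"
proof (cases "vnorm x = 0")
  case True
  then have "vnorm (A *\<^sub>v x) \<le> 0" using vnorm_mult_le[OF A x] by simp
  then show ?thesis using True by simp
next
  case False
  let ?y = "(1 / vnorm x) \<cdot>\<^sub>v x"
  have y: "?y \<in> carrier_vec d" "vnorm ?y = 1" using x False by (simp_all add: vnorm_smult)
  have "vnorm (A *\<^sub>v ?y) \<le> spec_norm d A"
    unfolding spec_norm_def using y by (intro cSup_upper spec_norm_bdd[OF A]) auto
  then have "vnorm (A *\<^sub>v x) / vnorm x \<le> spec_norm d A"
    using A x by (simp add: mult_mat_vec vnorm_smult)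
  moreover have "vnorm x > 0" using False vnorm_nonneg[of x] by linarith
  ultimately show ?thesis by (simp add: pos_divide_le_eq)
qed

lemma spec_norm_least:
  assumes d: "d \<ge> 1" and "\<And>x. x \<in> carrier_vec d \<Longrightarrow> vnorm x = 1 \<Longrightarrow> vnorm (A *\<^sub>v x) \<le> c"
  shows "spec_norm d A \<le> c"
  unfolding spec_norm_def
proof (rule cSup_least)
  show "{vnorm (A *\<^sub>v x) |x. x \<in> carrier_vec d \<and> vnorm x = 1} \<noteq> {}"
    using d vnorm_unit_vec[of 0 d] unit_vec_carrier[of d 0] by fastforce
qed (use assms(2) in auto)

lemma spec_norm_nonneg:
  assumes A: "A \<in> carrier_mat d d" and d: "d \<ge> 1"
  shows "spec_norm d A \<ge> 0"
  using spec_norm_upper[OF A, of "unit_vec d 0"] vnorm_unit_vec[of 0 d] d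
    vnorm_nonneg[of "A *\<^sub>v unit_vec d 0"] by (simp del: vnorm_nonneg)

lemma spec_norm_le_fro:
  assumes "A \<in> carrier_mat d d" "d \<ge> 1"
  shows "spec_norm d A \<le> fro d A"
  using vnorm_mult_le[OF assms(1)] assms(2) by (intro spec_norm_least) force+

lemma inner_gram:
  fixes A :: "real mat"
  assumes A: "A \<in> carrier_mat d d" and x: "x \<in> carrier_vec d" and y: "y \<in> carrier_vec d"
  shows "((transpose_mat A * A) *\<^sub>v x) \<bullet> y = (A *\<^sub>v x) \<bullet> (A *\<^sub>v y)"
  using transpose_vec_mult_scalar[OF A y, of "A *\<^sub>v x"] A x
  by (simp add: assoc_mult_mat_vec[of "transpose_mat A" d d A d x])

text \<open>The supremum defining the spectral norm is approached by almost-eigenvectors of the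
  Gram matrix; if the squared norm were not an eigenvalue, the inverse of the characteristic
  matrix would keep them away from the supremum.\<close>

lemma eigenvalue_spec_norm:
  assumes A: "A \<in> carrier_mat d d" and d: "d \<ge> 1"
  shows "eigenvalue (transpose_mat A * A) ((spec_norm d A)\<^sup>2)"
proof (rule ccontr)
  define \<sigma> where "\<sigma> = spec_norm d A"
  define S where "S = transpose_mat A * A"
  define C where "C = char_matrix S (\<sigma>\<^sup>2)"
  have S: "S \<in> carrier_mat d d" using A by (simp add: S_def)
  then have C: "C \<in> carrier_mat d d" by (simp add: C_def)
  assume "\<not> eigenvalue (transpose_mat A * A) ((spec_norm d A)\<^sup>2)"
  then have "det C \<noteq> 0"
    using eigenvalue_det[OF S] by (simp add: C_def S_def \<sigma>_def)
  then have "C \<in> Units (ring_mat TYPE(real) d ())"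
    by (rule det_non_zero_imp_unit[OF C])
  then obtain E where E: "E \<in> carrier_mat d d" "E * C = 1\<^sub>m d"
    by (auto simp: Units_def ring_mat_def)
  \<comment> \<open>The quadratic form of \<sigma>^2 I - S, that is, of - C; it is nonnegative
    because \<sigma> is the spectral norm.\<close>
  define q where "q x = \<sigma>\<^sup>2 * (vnorm x)\<^sup>2 - (vnorm (A *\<^sub>v x))\<^sup>2" for x
  have q_nonneg: "q x \<ge> 0" if "x \<in> carrier_vec d" for x
  proof -
    have "(vnorm (A *\<^sub>v x))\<^sup>2 \<le> (\<sigma> * vnorm x)\<^sup>2"
      using spec_norm_upper[OF A that] by (intro power_mono) (auto simp: \<sigma>_def)
    then show ?thesis by (simp add: q_def power_mult_distrib)
  qed
  have Cx: "C *\<^sub>v x = S *\<^sub>v x - \<sigma>\<^sup>2 \<cdot>\<^sub>v x" if x: "x \<in> carrier_vec d" for x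
  proof -
    have "C *\<^sub>v x = S *\<^sub>v x + ((- \<sigma>\<^sup>2) \<cdot>\<^sub>m 1\<^sub>m d) *\<^sub>v x"
      using S x unfolding C_def char_matrix_def
      by (subst add_mult_distrib_mat_vec[of _ d d]) auto
    also have "((- \<sigma>\<^sup>2) \<cdot>\<^sub>m 1\<^sub>m d) *\<^sub>v x = (- \<sigma>\<^sup>2) \<cdot>\<^sub>v x"
      using x by (intro eq_vecI) (auto simp: row_smult)
    finally show ?thesis
      using S x by (auto intro!: eq_vecI)
  qed
  \<comment> \<open>Nonnegativity of q is tested at x + t y with y = C x, where q (x + t y) = q x -
    2 t |y|^2 + t^2 q y. The choice t = 1 / (\<sigma>^2 + 1) makes the last term at most t
    |y|^2.\<close>
  have key: "(vnorm (C *\<^sub>v x))\<^sup>2 \<le> (\<sigma>\<^sup>2 + 1) * q x" if x: "x \<in> carrier_vec d" for x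
  proof -
    define y where "y = C *\<^sub>v x"
    have y: "y \<in> carrier_vec d" using C x by (simp add: y_def)
    define t where "t = 1 / (\<sigma>\<^sup>2 + 1)"
    have t: "t > 0" "t * \<sigma>\<^sup>2 \<le> 1" by (simp_all add: t_def add_nonneg_pos)
    have Ax: "A *\<^sub>v x \<in> carrier_vec d" and Ay: "A *\<^sub>v y \<in> carrier_vec d" using A x y by auto
    have yy: "y \<bullet> y = (A *\<^sub>v x) \<bullet> (A *\<^sub>v y) - \<sigma>\<^sup>2 * (x \<bullet> y)"
    proof -
      have "y \<bullet> y = (S *\<^sub>v x - \<sigma>\<^sup>2 \<cdot>\<^sub>v x) \<bullet> y" using Cx[OF x] by (simp add: y_def)
      also have "\<dots> = (S *\<^sub>v x) \<bullet> y - \<sigma>\<^sup>2 * (x \<bullet> y)"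
        using S x y by (subst minus_scalar_prod_distrib[of _ d]) auto
      finally show ?thesis using inner_gram[OF A x y] by (simp add: S_def)
    qed
    have "q (x + t \<cdot>\<^sub>v y) = q x - 2 * t * (y \<bullet> y) + t\<^sup>2 * q y"
    proof -
      have sq: "(u + t \<cdot>\<^sub>v z) \<bullet> (u + t \<cdot>\<^sub>v z) = u \<bullet> u + 2 * t * (u \<bullet> z) + t\<^sup>2 * (z \<bullet> z)"
        if "u \<in> carrier_vec d" "z \<in> carrier_vec d" for u z :: "real vec"
        using that comm_scalar_prod[of z d u]
        by (simp add: add_scalar_prod_distrib[of _ d] scalar_prod_add_distrib[of _ d] power2_eq_square algebra_simps)
      have "A *\<^sub>v (x + t \<cdot>\<^sub>v y) = A *\<^sub>v x + t \<cdot>\<^sub>v (A *\<^sub>v y)"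
        using A x y by (simp add: mult_add_distrib_mat_vec mult_mat_vec)
      moreover have "(A *\<^sub>v x) \<bullet> (A *\<^sub>v y) = y \<bullet> y + \<sigma>\<^sup>2 * (x \<bullet> y)" using yy by simp
      ultimately show ?thesis
        by (simp only: q_def vnorm_power2 sq[OF x y] sq[OF Ax Ay]) (simp add: algebra_simps)
    qed
    moreover have "q (x + t \<cdot>\<^sub>v y) \<ge> 0" using x y by (intro q_nonneg) auto
    moreover have "t\<^sup>2 * q y \<le> t * (y \<bullet> y)"
    proof -
      have "q y \<le> \<sigma>\<^sup>2 * (y \<bullet> y)" by (simp add: q_def vnorm_power2[of y])
      then have "t\<^sup>2 * q y \<le> t\<^sup>2 * (\<sigma>\<^sup>2 * (y \<bullet> y))" by (intro mult_left_mono) auto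
      also have "\<dots> = (t * (y \<bullet> y)) * (t * \<sigma>\<^sup>2)" by (simp add: power2_eq_square)
      also have "\<dots> \<le> (t * (y \<bullet> y)) * 1"
        using t by (intro mult_left_mono) (auto simp flip: vnorm_power2)
      finally show ?thesis by simp
    qed
    ultimately have "t * (y \<bullet> y) \<le> q x" by linarith
    moreover have "\<sigma>\<^sup>2 + 1 > 0" by (simp add: add_nonneg_pos)
    ultimately show ?thesis
      by (simp add: t_def vnorm_power2 y_def pos_divide_le_eq mult.commute)
  qed
  define K where "K = (fro d E)\<^sup>2 * (\<sigma>\<^sup>2 + 1)"
  \<comment> \<open>E inverts C, so |C x| is bounded below on the unit sphere. By \<open>key\<close>
    so is q, which contradicts \<sigma> being the least upper bound.\<close>
  have bound: "1 \<le> K * (\<sigma>\<^sup>2 - (vnorm (A *\<^sub>v x))\<^sup>2)" if x: "x \<in> carrier_vec d" "vnorm x = 1" for x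
  proof -
    have "x = E *\<^sub>v (C *\<^sub>v x)"
      using E C x by (simp add: assoc_mult_mat_vec[symmetric])
    then have "1 \<le> fro d E * vnorm (C *\<^sub>v x)"
      using vnorm_mult_le[OF E(1), of "C *\<^sub>v x"] C x by simp
    then have "1 \<le> (fro d E)\<^sup>2 * (vnorm (C *\<^sub>v x))\<^sup>2"
      by (metis one_le_power power_mult_distrib)
    also have "\<dots> \<le> (fro d E)\<^sup>2 * ((\<sigma>\<^sup>2 + 1) * q x)"
      by (intro mult_left_mono key x) simp
    finally show ?thesis using x by (simp add: K_def q_def mult.assoc)
  qed
  have K: "K > 0"
    using bound[of "unit_vec d 0"] d vnorm_unit_vec[of 0 d]
    by (metis K_def fro_nonneg less_eq_real_def less_le_not_le mult_eq_0_iff mult_nonneg_nonneg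
        add_nonneg_nonneg not_one_le_zero unit_vec_carrier zero_le_one zero_le_power2 less_eq_Suc_le One_nat_def)
  have "\<sigma> \<le> sqrt (\<sigma>\<^sup>2 - 1 / K)"
    unfolding \<sigma>_def
  proof (rule spec_norm_least[OF d], fold \<sigma>_def)
    fix x :: "real vec" assume "x \<in> carrier_vec d" "vnorm x = 1"
    from bound[OF this] have "(vnorm (A *\<^sub>v x))\<^sup>2 \<le> \<sigma>\<^sup>2 - 1 / K"
      using K by (simp add: field_simps)
    then show "vnorm (A *\<^sub>v x) \<le> sqrt (\<sigma>\<^sup>2 - 1 / K)"
      by (rule real_le_rsqrt)
  qed
  moreover have "\<sigma> \<ge> 0" unfolding \<sigma>_def by (rule spec_norm_nonneg[OF A d])
  moreover have "sqrt (\<sigma>\<^sup>2 - 1 / K) < sqrt (\<sigma>\<^sup>2)" using K by (intro real_sqrt_less_mono) simp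
  ultimately show False by simp
qed

text \<open>An eigenvalue of the Gram matrix is a quotient |A x|^2 / |x|^2, hence at most the
  squared norm, which is itself an eigenvalue. The characteristic polynomial supplies the finiteness
  that \<open>Max\<close> requires.\<close>

lemma lambda_max_gram:
  assumes A: "A \<in> carrier_mat d d" and d: "d \<ge> 1"
  shows "lambda_max (transpose_mat A * A) = (spec_norm d A)\<^sup>2"
  unfolding lambda_max_def
proof (rule Max_eqI)
  let ?S = "transpose_mat A * A"
  have S: "?S \<in> carrier_mat d d" using A by simp
  have "char_poly ?S \<noteq> 0"
    using degree_monic_char_poly[OF S] d by auto
  then show "finite {l. eigenvalue ?S l}"
    using poly_roots_finite[of "char_poly ?S"] by (simp add: eigenvalue_root_char_poly[OF S])
  show "(spec_norm d A)\<^sup>2 \<in> {l. eigenvalue ?S l}"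
    using eigenvalue_spec_norm[OF assms] by simp
  fix l assume "l \<in> {l. eigenvalue ?S l}"
  then obtain x where x: "x \<in> carrier_vec d" "x \<noteq> 0\<^sub>v d" "?S *\<^sub>v x = l \<cdot>\<^sub>v x"
    using S by (auto simp: eigenvalue_def eigenvector_def)
  have "l * (vnorm x)\<^sup>2 = (vnorm (A *\<^sub>v x))\<^sup>2"
    using inner_gram[OF A x(1) x(1)] x by (simp add: vnorm_power2)
  also have "\<dots> \<le> (spec_norm d A * vnorm x)\<^sup>2"
    by (intro power_mono spec_norm_upper[OF A x(1)]) simp
  finally have "l * (vnorm x)\<^sup>2 \<le> (spec_norm d A)\<^sup>2 * (vnorm x)\<^sup>2"
    by (simp add: power_mult_distrib)
  moreover have "(vnorm x)\<^sup>2 > 0" using vnorm_eq_0[OF x(1)] x(2) by auto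
  ultimately show "l \<le> (spec_norm d A)\<^sup>2" by (rule mult_right_le_imp_le)
qed

text \<open>Lists of rationals form a countable type, so quantifying over them preserves
  measurability, unlike the supremum over the unit sphere.\<close>

definition rat_vector :: "rat list \<Rightarrow> nat \<Rightarrow> real" where
  "rat_vector l r = (if r < length l then of_rat (l ! r) else 0)"

text \<open>By density of the rationals and continuity of both sides. The condition is homogeneous
  because the rational approximants of a unit vector need not have norm 1.\<close>

lemma spec_norm_le_iff_rat:
  assumes A: "A \<in> carrier_mat d d" and d: "d \<ge> 1" and c: "c \<ge> 0"
  shows "spec_norm d A \<le> c \<longleftrightarrow>
    (\<forall>l. vnorm (A *\<^sub>v vec d (rat_vector l)) \<le> c * vnorm (vec d (rat_vector l)))"
proof safe
  fix l assume "spec_norm d A \<le> c"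
  then show "vnorm (A *\<^sub>v vec d (rat_vector l)) \<le> c * vnorm (vec d (rat_vector l))"
    by (intro order_trans[OF spec_norm_upper[OF A]] mult_right_mono) auto
next
  assume *: "\<forall>l. vnorm (A *\<^sub>v vec d (rat_vector l)) \<le> c * vnorm (vec d (rat_vector l))"
  show "spec_norm d A \<le> c"
  proof (rule spec_norm_least[OF d])
    fix x :: "real vec" assume x: "x \<in> carrier_vec d" "vnorm x = 1"
    have "\<forall>n r. \<exists>q. x $ r < of_rat q \<and> of_rat q < x $ r + 1 / Suc n"
      by (intro allI of_rat_dense) simp
    then have "\<exists>Q. \<forall>n r. x $ r < of_rat (Q n r) \<and> of_rat (Q n r) < x $ r + 1 / Suc n"
      by (simp only: choice_iff)
    then obtain Q where Q: "x $ r < of_rat (Q n r)" "of_rat (Q n r) < x $ r + 1 / Suc n" for n r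
      by blast
    define y where "y n = vec d (rat_vector (map (Q n) [0..<d]))" for n
    have y: "y n \<in> carrier_vec d" for n by (simp add: y_def)
    have lim: "(\<lambda>n. y n $ r) \<longlonglongrightarrow> x $ r" if "r < d" for r
    proof (rule real_tendsto_sandwich[of "\<lambda>_. x $ r" _ _ "\<lambda>n. x $ r + 1 / Suc n"])
      show "(\<lambda>n. x $ r + 1 / Suc n) \<longlonglongrightarrow> x $ r"
        using tendsto_add[OF tendsto_const LIMSEQ_inverse_real_of_nat, of "x $ r"]
        by (simp add: inverse_eq_divide)
    qed (use Q that in \<open>auto intro!: always_eventually less_imp_le simp: y_def rat_vector_def\<close>)
    have vn: "vnorm z = sqrt (\<Sum>p<d. (z $ p)\<^sup>2)" if "z \<in> carrier_vec d" for z
      using vnorm_power2_sum[OF that] real_sqrt_abs[of "vnorm z"] by simp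
    have Az: "vnorm (A *\<^sub>v z) = sqrt (\<Sum>p<d. (\<Sum>q<d. A $$ (p, q) * z $ q)\<^sup>2)" if "z \<in> carrier_vec d" for z
      using A that by (subst vn) (auto simp: scalar_prod_def lessThan_atLeast0 intro!: sum.cong arg_cong[where f=sqrt])
    have "(\<lambda>n. vnorm (A *\<^sub>v y n)) \<longlonglongrightarrow> vnorm (A *\<^sub>v x)"
      unfolding Az[OF y] Az[OF x(1)] by (intro tendsto_intros lim) auto
    moreover have "(\<lambda>n. c * vnorm (y n)) \<longlonglongrightarrow> c * vnorm x"
      unfolding vn[OF y] vn[OF x(1)] by (intro tendsto_intros lim) auto
    ultimately have "vnorm (A *\<^sub>v x) \<le> c * vnorm x"
      by (rule LIMSEQ_le) (use * in \<open>auto simp: y_def\<close>)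
    then show "vnorm (A *\<^sub>v x) \<le> c" using x by simp
  qed
qed

section \<open>The matrix products through their action on vectors\<close>

lemma Pimat_carrier [simp]: "Pimat \<eta> b d w k \<in> carrier_mat d d"
  by (induction k) (auto simp: Mmat_def Hmat_def)

lemma Mmat_mult_vec:
  "Mmat \<eta> b d w (Suc k) *\<^sub>v vec d u = vec d (step (\<eta> / real b) {b * k + 1 .. b * Suc k} d w u)"
proof (rule eq_vecI)
  fix p assume "p < dim_vec (vec d (step (\<eta> / real b) {b * k + 1 .. b * Suc k} d w u))"
  then have p: "p < d" by simp
  let ?I = "{b * k + 1 .. b * Suc k}" and ?\<kappa> = "\<eta> / real b"
  have "(Mmat \<eta> b d w (Suc k) *\<^sub>v vec d u) $ p
      = (\<Sum>q<d. ((if p = q then 1 else 0) - ?\<kappa> * (\<Sum>i\<in>?I. w (i, p) * w (i, q))) * u q)"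
    using p by (auto simp: Mmat_def Hmat_def avec_def scalar_prod_def lessThan_atLeast0 intro!: sum.cong)
  also have "\<dots> = (\<Sum>q<d. (if p = q then u q else 0)) - (\<Sum>q<d. ?\<kappa> * (\<Sum>i\<in>?I. w (i, p) * w (i, q)) * u q)"
    by (subst sum_subtractf[symmetric]) (auto intro!: sum.cong simp: algebra_simps)
  also have "(\<Sum>q<d. (if p = q then u q else 0)) = u p"
    using p by simp
  also have "(\<Sum>q<d. ?\<kappa> * (\<Sum>i\<in>?I. w (i, p) * w (i, q)) * u q)
      = ?\<kappa> * (\<Sum>q<d. \<Sum>i\<in>?I. w (i, p) * (w (i, q) * u q))"
    by (simp add: sum_distrib_left sum_distrib_right mult.assoc)
  also have "(\<Sum>q<d. \<Sum>i\<in>?I. w (i, p) * (w (i, q) * u q)) = (\<Sum>i\<in>?I. w (i, p) * (\<Sum>q<d. w (i, q) * u q))"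
    by (subst sum.swap) (simp add: sum_distrib_left)
  finally show "(Mmat \<eta> b d w (Suc k) *\<^sub>v vec d u) $ p = vec d (step ?\<kappa> ?I d w u) $ p"
    using p by (simp add: step_def)
qed (simp add: Mmat_def Hmat_def)

lemma Pimat_mult_vec:
  "Pimat \<eta> b d w k *\<^sub>v vec d u = vec d (iter (\<eta> / real b) b d w k u)"
proof (induction k)
  case (Suc k)
  have "Mmat \<eta> b d w (Suc k) \<in> carrier_mat d d" by (auto simp: Mmat_def Hmat_def)
  then show ?case
    by (simp add: assoc_mult_mat_vec[OF _ Pimat_carrier] Suc.IH del: mult_Suc_right)
       (simp add: Mmat_mult_vec del: mult_Suc_right)
qed simp

lemma vnorm_Pimat: "vnorm (Pimat \<eta> b d w k *\<^sub>v vec d u) = nrm d (iter (\<eta> / real b) b d w k u)"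
  by (simp add: Pimat_mult_vec vnorm_vec)

lemma unit_vec_eq_vec: "unit_vec d j = vec d (unit_vector j)"
  by (auto simp: unit_vec_def unit_vector_def)

lemma spec_norm_Pimat_ge:
  assumes "j < d"
  shows "nrm d (iter (\<eta> / real b) b d w k (unit_vector j)) \<le> spec_norm d (Pimat \<eta> b d w k)"
  using spec_norm_upper[of "Pimat \<eta> b d w k" d "unit_vec d j"] assms
  by (simp add: unit_vec_eq_vec vnorm_Pimat vnorm_vec nrm_unit_vector)

text \<open>The squared Frobenius norm sums d squared column norms, each at most c^2; this is the
  origin of the factor sqrt d.\<close>

lemma spec_norm_Pimat_le:
  assumes "d \<ge> 1" "\<And>j. j < d \<Longrightarrow> nrm d (iter (\<eta> / real b) b d w k (unit_vector j)) \<le> c" "c \<ge> 0"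
  shows "spec_norm d (Pimat \<eta> b d w k) \<le> sqrt d * c"
proof -
  have "(spec_norm d (Pimat \<eta> b d w k))\<^sup>2 \<le> (fro d (Pimat \<eta> b d w k))\<^sup>2"
    using assms(1) by (intro power_mono spec_norm_le_fro spec_norm_nonneg) auto
  also have "\<dots> = (\<Sum>j<d. (nrm d (iter (\<eta> / real b) b d w k (unit_vector j)))\<^sup>2)"
    by (simp add: fro_columns[OF Pimat_carrier] unit_vec_eq_vec vnorm_Pimat)
  also have "\<dots> \<le> (\<Sum>j<d. c\<^sup>2)"
    using assms by (intro sum_mono power_mono) auto
  also have "\<dots> = (sqrt d * c)\<^sup>2" by (simp add: power_mult_distrib)
  finally show ?thesis
    by (rule power2_le_imp_le) (use assms in simp)
qed

context gaussian_data
begin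

lemma measurable_spec_norm [measurable]:
  assumes d: "d \<ge> 1"
  shows "(\<lambda>w. spec_norm d (Pimat \<eta> b d w k)) \<in> borel_measurable P"
  unfolding borel_measurable_iff_le
proof
  fix c :: real
  show "{w \<in> space P. spec_norm d (Pimat \<eta> b d w k) \<le> c} \<in> sets P"
  proof (cases "c \<ge> 0")
    case True
    have "{w \<in> space P. spec_norm d (Pimat \<eta> b d w k) \<le> c}
        = {w \<in> space P. \<forall>l. nrm d (iter (\<eta> / real b) b d w k (rat_vector l)) \<le> c * nrm d (rat_vector l)}"
      by (simp add: spec_norm_le_iff_rat[OF Pimat_carrier d True] vnorm_Pimat vnorm_vec)
    also have "\<dots> \<in> sets P" by measurable
    finally show ?thesis .
  next
    case False
    then have "{w \<in> space P. spec_norm d (Pimat \<eta> b d w k) \<le> c} = {}"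
      using order_trans[OF spec_norm_nonneg[OF Pimat_carrier d]] by auto
    then show ?thesis by simp
  qed
qed

end

section \<open>Moments of a single step\<close>

lemma unit_vector_same [simp]: "unit_vector j j = 1"
  by (simp add: unit_vector_def)

lemma step_unit_vector:
  assumes "d \<ge> 1"
  shows "step \<kappa> I d w (unit_vector 0) p = unit_vector 0 p - \<kappa> * (\<Sum>i\<in>I. w (i, p) * w (i, 0))"
proof -
  have "(\<Sum>q<d. w (i, q) * unit_vector 0 q) = (\<Sum>q<d. if q = 0 then w (i, q) else 0)" for i
    by (intro sum.cong) (auto simp: unit_vector_def)
  then have "(\<Sum>q<d. w (i, q) * unit_vector 0 q) = w (i, 0)" for i
    using assms by simp
  then show ?thesis by (simp add: step_def)
qed

lemma abs_coord_le_nrm: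
  assumes "r < d"
  shows "\<bar>u r\<bar> \<le> nrm d u"
proof -
  have "u r \<le> nrm d u" "- u r \<le> nrm d (\<lambda>r. - u r)"
    using assms unfolding nrm_def by (auto intro: member_le_L2_set[where f=u] member_le_L2_set[where f="\<lambda>r. - u r"])
  then show ?thesis by (simp add: nrm_uminus abs_le_iff)
qed

text \<open>Keeping only coordinate 0 leaves an expression in the squares of the first data
  coordinates. It is all that positivity, negative moments and large values of the norm
  require.\<close>

lemma nrm_step_ge:
  assumes "d \<ge> 1"
  shows "\<bar>1 - \<kappa> * (\<Sum>i\<in>I. (w (i, 0))\<^sup>2)\<bar> \<le> nrm d (step \<kappa> I d w (unit_vector 0))"
  using abs_coord_le_nrm[of 0 d "step \<kappa> I d w (unit_vector 0)"] assms
  by (simp add: step_unit_vector power2_eq_square)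

text \<open>A crude bound, linear in the sum of squares, so that Gaussian exponential square moments
  control it. The squares of coordinate 0 recur in each of the d coordinates, which gives d +
  1.\<close>

lemma nrm_step_le:
  assumes d: "d \<ge> 1" and I: "finite I" and \<kappa>: "\<kappa> \<ge> 0"
  shows "nrm d (step \<kappa> I d w (unit_vector 0)) \<le> 1 + \<kappa> * (d + 1) * (\<Sum>j\<in>I \<times> {..<d}. (w j)\<^sup>2)"
proof -
  let ?Q = "\<Sum>j\<in>I \<times> {..<d}. (w j)\<^sup>2"
  have Q: "?Q = (\<Sum>p<d. \<Sum>i\<in>I. (w (i, p))\<^sup>2)"
    by (subst sum.swap) (simp add: sum.cartesian_product case_prod_beta')
  have *: "\<bar>x * y\<bar> \<le> x\<^sup>2 + y\<^sup>2" for x y :: real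
  proof -
    have "2 * \<bar>x * y\<bar> \<le> x\<^sup>2 + y\<^sup>2" using sum_squares_bound[of "\<bar>x\<bar>" "\<bar>y\<bar>"] by (simp add: abs_mult)
    then show ?thesis using abs_ge_zero[of "x * y"] by linarith
  qed
  have "nrm d (step \<kappa> I d w (unit_vector 0)) \<le> (\<Sum>p<d. \<bar>unit_vector 0 p - \<kappa> * (\<Sum>i\<in>I. w (i, p) * w (i, 0))\<bar>)"
    using L2_set_le_sum_abs[of "step \<kappa> I d w (unit_vector 0)" "{..<d}"] d
    by (simp add: nrm_def step_unit_vector)
  also have "\<dots> \<le> (\<Sum>p<d. unit_vector 0 p + \<kappa> * (\<Sum>i\<in>I. (w (i, p))\<^sup>2 + (w (i, 0))\<^sup>2))"
  proof (rule sum_mono)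
    fix p
    have "\<bar>\<kappa> * (\<Sum>i\<in>I. w (i, p) * w (i, 0))\<bar> \<le> \<kappa> * (\<Sum>i\<in>I. (w (i, p))\<^sup>2 + (w (i, 0))\<^sup>2)"
      using \<kappa> unfolding abs_mult by (intro mult_mono order_trans[OF sum_abs] sum_mono *) auto
    moreover have "\<bar>unit_vector 0 p\<bar> = unit_vector 0 p" by (simp add: unit_vector_def)
    ultimately show "\<bar>unit_vector 0 p - \<kappa> * (\<Sum>i\<in>I. w (i, p) * w (i, 0))\<bar>
      \<le> unit_vector 0 p + \<kappa> * (\<Sum>i\<in>I. (w (i, p))\<^sup>2 + (w (i, 0))\<^sup>2)" by linarith
  qed
  also have "\<dots> = 1 + \<kappa> * (?Q + d * (\<Sum>i\<in>I. (w (i, 0))\<^sup>2))"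
    using d by (simp add: sum.distrib sum_distrib_left[symmetric] Q unit_vector_def)
  also have "\<dots> \<le> 1 + \<kappa> * (?Q + d * ?Q)"
  proof -
    have "(\<Sum>i\<in>I. (w (i, 0))\<^sup>2) \<le> ?Q"
      unfolding Q using d by (intro member_le_sum) (auto intro: sum_nonneg)
    then show ?thesis using \<kappa> by (intro add_mono mult_left_mono) auto
  qed
  finally show ?thesis by (simp add: algebra_simps)
qed

section \<open>Integrability, positivity and nondegeneracy of a step\<close>

context gaussian_data
begin

lemma nn_integral_coord_prod:
  assumes [measurable]: "f \<in> borel_measurable borel" and "finite J"
  shows "(\<integral>\<^sup>+w. (\<Prod>j\<in>J. f (w j)) \<partial>P) = (\<integral>\<^sup>+x. f x \<partial>N) ^ card J"
  using assms(2)
proof (induction J)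
  case empty
  then show ?case by (simp add: D.emeasure_space_1[simplified])
next
  case (insert j J)
  have [measurable]: "(\<lambda>w. \<Prod>j\<in>J. f (w j)) \<in> borel_measurable P" by measurable
  have "(\<integral>\<^sup>+w. (\<Prod>k\<in>insert j J. f (w k)) \<partial>P) = (\<integral>\<^sup>+w. f (w j) * (\<Prod>k\<in>J. f (w k)) \<partial>P)"
    using insert.hyps by simp
  also have "\<dots> = (\<integral>\<^sup>+w. \<integral>\<^sup>+x. f ((w(j := x)) j) * (\<Prod>k\<in>J. f ((w(j := x)) k)) \<partial>N \<partial>P)"
    by (rule nn_integral_resample) measurable
  also have "\<dots> = (\<integral>\<^sup>+w. \<integral>\<^sup>+x. f x * (\<Prod>k\<in>J. f (w k)) \<partial>N \<partial>P)"
  proof -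
    have "(\<Prod>k\<in>J. f ((w(j := x)) k)) = (\<Prod>k\<in>J. f (w k))" for w x
      using insert.hyps by (intro prod.cong) auto
    then show ?thesis by simp
  qed
  also have "\<dots> = (\<integral>\<^sup>+x. f x \<partial>N) * (\<integral>\<^sup>+w. (\<Prod>k\<in>J. f (w k)) \<partial>P)"
    by (simp add: nn_integral_multc nn_integral_cmult)
  finally show ?case using insert by simp
qed

text \<open>The exponent 1 / (4 v) is half of that in the density, so the product is sqrt 2 times
  the density of variance 2 v.\<close>

lemma nn_integral_exp_square: "(\<integral>\<^sup>+x. ennreal (exp (x\<^sup>2 / (4 * v))) \<partial>N) = ennreal (sqrt 2)"
proof -
  have "normal_density 0 (sqrt v) x * exp (x\<^sup>2 / (4 * v)) = sqrt 2 * normal_density 0 (sqrt (2 * v)) x" for x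
  proof -
    have "- (x\<^sup>2 / (2 * v)) + x\<^sup>2 / (4 * v) = - (x\<^sup>2 / (4 * v))"
      using v_pos by (simp add: field_simps)
    then have "exp (- (x\<^sup>2 / (2 * v))) * exp (x\<^sup>2 / (4 * v)) = exp (- (x\<^sup>2 / (4 * v)))"
      by (simp add: exp_add[symmetric])
    then show ?thesis
      using v_pos by (simp add: normal_density_def real_sqrt_mult field_simps)
  qed
  then have "(\<integral>\<^sup>+x. ennreal (exp (x\<^sup>2 / (4 * v))) \<partial>N) = (\<integral>\<^sup>+x. ennreal (sqrt 2) * ennreal (normal_density 0 (sqrt (2 * v)) x) \<partial>lborel)"
    by (simp add: nn_integral_density ennreal_mult'[symmetric])
  also have "\<dots> = ennreal (sqrt 2)"
  proof -
    interpret N2: prob_space "density lborel (normal_density 0 (sqrt (2 * v)))"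
      using v_pos by (intro prob_space_normal_density) simp
    show ?thesis
      using N2.emeasure_space_1 by (simp add: nn_integral_cmult emeasure_density)
  qed
  finally show ?thesis .
qed

lemma moment_finite_pos:
  assumes d: "d \<ge> 1" and I: "finite I" and \<kappa>: "\<kappa> > 0" and s: "s > 0"
  shows "moment \<kappa> I d s < \<infinity>"
proof -
  define L where "L = \<kappa> * (d + 1)"
  define \<delta> where "\<delta> = 1 / (4 * v)"
  \<comment> \<open>Chosen so that 1 + L Q <= K (1 + \<delta> Q / s) <= K exp (\<delta> Q / s); the
    power s of this contains exp (\<delta> Q), a product over coordinates with the exponent
    integrated above.\<close>
  define K where "K = max 1 (L * s / \<delta>)"
  define J where "J = I \<times> {..<d}"
  have pos: "L > 0" "\<delta> > 0" "K \<ge> 1" using \<kappa> v_pos by (auto simp: L_def \<delta>_def K_def)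
  have J: "finite J" using I by (simp add: J_def)
  have bound: "nrm d (step \<kappa> I d w (unit_vector 0)) powr s \<le> K powr s * (\<Prod>j\<in>J. exp ((w j)\<^sup>2 / (4 * v)))" for w
  proof -
    define Q where "Q = (\<Sum>j\<in>J. (w j)\<^sup>2)"
    have Q: "Q \<ge> 0" by (simp add: Q_def sum_nonneg)
    have "nrm d (step \<kappa> I d w (unit_vector 0)) \<le> 1 + L * Q"
      using nrm_step_le[OF d I, of \<kappa> w] \<kappa> by (simp add: L_def Q_def J_def)
    also have "\<dots> \<le> K * (1 + \<delta> * Q / s)"
    proof -
      have "L * s / \<delta> \<le> K" by (simp add: K_def)
      then have "L \<le> K * (\<delta> / s)" using pos s by (simp add: field_simps)
      then have "L * Q \<le> K * (\<delta> / s) * Q" using Q by (rule mult_right_mono)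
      then show ?thesis using pos by (simp add: algebra_simps)
    qed
    also have "\<dots> \<le> K * exp (\<delta> * Q / s)"
      using pos by (intro mult_left_mono exp_ge_add_one_self) auto
    finally have "nrm d (step \<kappa> I d w (unit_vector 0)) powr s \<le> (K * exp (\<delta> * Q / s)) powr s"
      using s by (intro powr_mono2) auto
    also have "\<dots> = K powr s * exp (\<delta> * Q)"
      using pos s by (simp add: powr_mult) (simp add: powr_def)
    also have "exp (\<delta> * Q) = (\<Prod>j\<in>J. exp ((w j)\<^sup>2 / (4 * v)))"
      using J by (simp add: \<delta>_def Q_def exp_sum[symmetric] sum_divide_distrib)
    finally show ?thesis .
  qed
  have "moment \<kappa> I d s \<le> (\<integral>\<^sup>+w. ennreal (K powr s) * (\<Prod>j\<in>J. ennreal (exp ((w j)\<^sup>2 / (4 * v)))) \<partial>P)"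
    unfolding moment_def
    by (intro nn_integral_mono) (simp add: prod_ennreal ennreal_mult'[symmetric] prod_nonneg ennreal_leI bound)
  also have "\<dots> = ennreal (K powr s) * ennreal (sqrt 2) ^ card J"
    using J by (subst nn_integral_cmult) (simp_all add: nn_integral_coord_prod[where f="\<lambda>x. ennreal (exp (x\<^sup>2 / (4 * v)))"] nn_integral_exp_square)
  also have "\<dots> < \<infinity>" by (simp add: ennreal_power ennreal_mult_less_top)
  finally show ?thesis .
qed

lemma AE_N_square_neq:
  assumes "\<kappa> \<noteq> 0"
  shows "AE x in N. C - \<kappa> * x\<^sup>2 \<noteq> 0"
proof -
  have "{x. C - \<kappa> * x\<^sup>2 = 0} \<subseteq> {sqrt (C / \<kappa>), - sqrt (C / \<kappa>)}"
  proof
    fix x assume "x \<in> {x. C - \<kappa> * x\<^sup>2 = 0}"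
    then have "C / \<kappa> = x\<^sup>2" using assms by (simp add: field_simps)
    then have "sqrt (C / \<kappa>) = \<bar>x\<bar>" by simp
    then show "x \<in> {sqrt (C / \<kappa>), - sqrt (C / \<kappa>)}" by auto
  qed
  then have "finite {x. C - \<kappa> * x\<^sup>2 = 0}" by (rule finite_subset) simp
  then have "AE x in lborel. x \<notin> {x. C - \<kappa> * x\<^sup>2 = 0}"
    by (intro AE_not_in finite_imp_null_set_lborel)
  then show ?thesis by (auto simp: AE_density)
qed

lemma AE_P_resample:
  assumes [measurable]: "Measurable.pred P Q" and "\<And>w. AE x in N. Q (w(p := x))"
  shows "AE w in P. Q w"
proof -
  have "(\<integral>\<^sup>+w. (if Q w then 0 else 1) \<partial>P) = (\<integral>\<^sup>+w. \<integral>\<^sup>+x. (if Q (w(p := x)) then 0 else 1) \<partial>N \<partial>P)"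
    by (rule nn_integral_resample) measurable
  also have "\<dots> = (\<integral>\<^sup>+w. 0 \<partial>P)"
  proof (rule nn_integral_cong)
    fix w
    have "(\<integral>\<^sup>+x. (if Q (w(p := x)) then 0 else 1 :: ennreal) \<partial>N) = (\<integral>\<^sup>+x. 0 \<partial>N)"
      using assms(2)[of w] by (intro nn_integral_cong_AE) auto
    then show "(\<integral>\<^sup>+x. (if Q (w(p := x)) then 0 else 1 :: ennreal) \<partial>N) = 0" by simp
  qed
  finally have "(\<integral>\<^sup>+w. (if Q w then 0 else 1 :: ennreal) \<partial>P) = 0" by simp
  then have "AE w in P. (if Q w then 0 else 1 :: ennreal) = 0"
    by (subst (asm) nn_integral_0_iff_AE) auto
  then show ?thesis by eventually_elim (auto split: if_splits)
qed

lemma square_sum_upd: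
  fixes x \<kappa> :: real
  assumes "finite I" "a \<in> I"
  shows "1 - \<kappa> * (\<Sum>i\<in>I. ((w((a, 0) := x)) (i, 0))\<^sup>2)
    = (1 - \<kappa> * (\<Sum>i\<in>I - {a}. (w (i, 0 :: nat))\<^sup>2)) - \<kappa> * x\<^sup>2"
proof -
  have "(\<Sum>i\<in>I. ((w((a, 0) := x)) (i, 0))\<^sup>2) = x\<^sup>2 + (\<Sum>i\<in>I - {a}. (w (i, 0))\<^sup>2)"
    using assms by (subst sum.remove[of I a]) (auto intro!: sum.cong)
  then show ?thesis by (simp add: algebra_simps)
qed

text \<open>With one coordinate x released and the others frozen, coordinate 0 of the step is C -
  \<kappa> x^2, which has at most two zeros.\<close>

lemma AE_nrm_step_pos:
  assumes d: "d \<ge> 1" and I: "finite I" "I \<noteq> {}" and \<kappa>: "\<kappa> > 0"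
  shows "AE w in P. nrm d (step \<kappa> I d w (unit_vector 0)) > 0"
proof -
  obtain a where a: "a \<in> I" using I by auto
  show ?thesis
  proof (rule AE_P_resample[of _ "(a, 0)"])
    fix w :: "nat \<times> nat \<Rightarrow> real"
    have "AE x in N. (1 - \<kappa> * (\<Sum>i\<in>I - {a}. (w (i, 0))\<^sup>2)) - \<kappa> * x\<^sup>2 \<noteq> 0"
      using \<kappa> by (intro AE_N_square_neq) simp
    then show "AE x in N. nrm d (step \<kappa> I d (w((a, 0) := x)) (unit_vector 0)) > 0"
    proof eventually_elim
      case (elim x)
      then show ?case
        using nrm_step_ge[OF d, of \<kappa> "w((a, 0) := x)" I] square_sum_upd[OF I(1) a, of \<kappa> w x] by simp
    qed
  qed measurable
qed

text \<open>Uniformity in r is the point: the density is bounded, the singularity has integral 2 on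
  each side, and at distance more than 1 from r the integrand is at most 1.\<close>

lemma inverse_sqrt_moment:
  obtains K where "K < \<infinity>" "\<And>r. (\<integral>\<^sup>+x. ennreal (\<bar>x - r\<bar> powr - (1/2)) \<partial>N) \<le> K"
proof -
  define f where "f y = ennreal (indicator {0..1} y * y powr - (1/2))" for y :: real
  have [measurable]: "f \<in> borel_measurable borel" unfolding f_def by measurable
  have f: "(\<integral>\<^sup>+y. f y \<partial>lborel) = 2"
    using nn_integral_has_integral_lebesgue[OF _ has_integral_powr_from_0[of "- (1/2)" 1]]
    by (simp add: f_def)
  define c where "c = 1 / sqrt (2 * pi * v)"
  have dens: "normal_density 0 (sqrt v) x \<le> c" for x
    using v_pos by (simp add: normal_density_def c_def divide_right_mono)
  have bound: "ennreal (\<bar>y\<bar> powr - (1/2)) \<le> 1 + (f y + f (- y))" for y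
  proof (cases "\<bar>y\<bar> \<le> 1")
    case True
    then have "ennreal (\<bar>y\<bar> powr - (1/2)) \<le> f y + f (- y)"
      by (cases "y \<ge> 0") (auto simp: f_def indicator_def)
    then show ?thesis by (rule order_trans) simp
  next
    case False
    then have "\<bar>y\<bar> powr - (1/2) \<le> \<bar>y\<bar> powr 0" by (intro powr_mono) auto
    then have "\<bar>y\<bar> powr - (1/2) \<le> 1" using False by (cases "y = 0") auto
    then have "ennreal (\<bar>y\<bar> powr - (1/2)) \<le> 1" by (simp add: ennreal_le_1)
    then show ?thesis by (rule order_trans) simp
  qed
  have bd: "(\<integral>\<^sup>+x. ennreal (\<bar>x - r\<bar> powr - (1/2)) \<partial>N) \<le> 1 + ennreal c * 4" for r
  proof -
    have t1: "(\<integral>\<^sup>+x. f (x - r) \<partial>lborel) = 2"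
      using nn_integral_real_affine[of f 1 "- r"] f by simp
    have t2: "(\<integral>\<^sup>+x. f (r - x) \<partial>lborel) = 2"
      using nn_integral_real_affine[of f "-1" r] f by simp
    have "(\<integral>\<^sup>+x. ennreal (\<bar>x - r\<bar> powr - (1/2)) \<partial>N) \<le> (\<integral>\<^sup>+x. 1 + (f (x - r) + f (r - x)) \<partial>N)"
      using bound[of "x - r" for x] by (intro nn_integral_mono) simp
    also have "\<dots> = 1 + (\<integral>\<^sup>+x. f (x - r) + f (r - x) \<partial>N)"
      by (subst nn_integral_add) (simp_all add: N.emeasure_space_1[simplified])
    also have "(\<integral>\<^sup>+x. f (x - r) + f (r - x) \<partial>N)
        = (\<integral>\<^sup>+x. ennreal (normal_density 0 (sqrt v) x) * (f (x - r) + f (r - x)) \<partial>lborel)"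
      by (subst nn_integral_density) simp_all
    also have "\<dots> \<le> (\<integral>\<^sup>+x. ennreal c * (f (x - r) + f (r - x)) \<partial>lborel)"
      using dens by (intro nn_integral_mono mult_right_mono ennreal_leI) auto
    also have "\<dots> = ennreal c * 4"
      by (simp add: nn_integral_cmult nn_integral_add t1 t2)
    finally show ?thesis by (simp add: add_mono)
  qed
  have fin: "1 + ennreal c * 4 < \<infinity>" by (simp add: ennreal_mult_less_top)
  show ?thesis by (rule that[OF fin bd])
qed

text \<open>For D = r^2 the polynomial factors as (r - x)(r + x), and a b <= a^2 + b^2 trades a
  product of powers -1/4 for a sum of powers -1/2, which are still integrable. For D < 0 it is at
  least x^2 in modulus, so r = 0 serves.\<close>

lemma quarter_powr_le:
  fixes x D :: real
  assumes "D - x\<^sup>2 \<noteq> 0" "x \<noteq> 0"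
  shows "\<bar>D - x\<^sup>2\<bar> powr - (1/4) \<le> \<bar>x - sqrt (max D 0)\<bar> powr - (1/2) + \<bar>x + sqrt (max D 0)\<bar> powr - (1/2)"
proof (cases "D \<ge> 0")
  case True
  define r where "r = sqrt D"
  have D: "D = r\<^sup>2" using True by (simp add: r_def)
  define a b where "a = \<bar>x - r\<bar> powr - (1/4)" and "b = \<bar>x + r\<bar> powr - (1/4)"
  have "\<bar>D - x\<^sup>2\<bar> = \<bar>x - r\<bar> * \<bar>x + r\<bar>"
    by (simp add: D abs_mult[symmetric] power2_eq_square algebra_simps abs_minus_commute)
  then have "\<bar>D - x\<^sup>2\<bar> powr - (1/4) = a * b" by (simp add: a_def b_def powr_mult)
  also have "\<dots> \<le> a\<^sup>2 + b\<^sup>2"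
  proof -
    have "0 \<le> a * b" by (simp add: a_def b_def)
    then show ?thesis using sum_squares_bound[of a b] by linarith
  qed
  also have "a\<^sup>2 + b\<^sup>2 = \<bar>x - r\<bar> powr - (1/2) + \<bar>x + r\<bar> powr - (1/2)"
    by (simp add: a_def b_def power2_eq_square powr_add[symmetric])
  finally show ?thesis using True by (simp add: r_def max_def)
next
  case False
  have "\<bar>D - x\<^sup>2\<bar> powr - (1/4) \<le> (\<bar>x\<bar> * \<bar>x\<bar>) powr - (1/4)"
    using False assms by (intro powr_mono2') (auto simp: power2_eq_square)
  also have "\<dots> = \<bar>x\<bar> powr - (1/4) * \<bar>x\<bar> powr - (1/4)"
    by (simp only: powr_mult abs_ge_zero)
  also have "\<dots> = \<bar>x\<bar> powr - (1/2)"
    by (simp add: powr_add[symmetric])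
  also have "\<dots> \<le> \<bar>x\<bar> powr - (1/2) + \<bar>x\<bar> powr - (1/2)" by simp
  finally show ?thesis using False by (simp add: max_def)
qed

lemma moment_finite_neg:
  assumes d: "d \<ge> 1" and I: "finite I" "I \<noteq> {}" and \<kappa>: "\<kappa> > 0"
  shows "moment \<kappa> I d (- (1/4)) < \<infinity>"
proof -
  obtain a where a: "a \<in> I" using I by auto
  obtain K where K: "K < \<infinity>" "\<And>r. (\<integral>\<^sup>+x. ennreal (\<bar>x - r\<bar> powr - (1/2)) \<partial>N) \<le> K"
    using inverse_sqrt_moment by blast
  let ?R = "\<lambda>w. nrm d (step \<kappa> I d w (unit_vector 0))"
  let ?c = "ennreal (\<kappa> powr - (1/4))"
  have inner: "(\<integral>\<^sup>+x. ennreal (?R (w((a, 0) := x)) powr - (1/4)) \<partial>N) \<le> ?c * (K + K)" for w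
  proof -
    define C where "C = 1 - \<kappa> * (\<Sum>i\<in>I - {a}. (w (i, 0))\<^sup>2)"
    define r where "r = sqrt (max (C / \<kappa>) 0)"
    have "AE x in N. C - \<kappa> * x\<^sup>2 \<noteq> 0" "AE x in N. 0 - \<kappa> * x\<^sup>2 \<noteq> 0"
      by (rule AE_N_square_neq, use \<kappa> in simp)+
    then have "AE x in N. ennreal (?R (w((a, 0) := x)) powr - (1/4))
        \<le> ?c * (ennreal (\<bar>x - r\<bar> powr - (1/2)) + ennreal (\<bar>x - (- r)\<bar> powr - (1/2)))"
    proof eventually_elim
      case (elim x)
      have eq: "C - \<kappa> * x\<^sup>2 = \<kappa> * (C / \<kappa> - x\<^sup>2)" using \<kappa> by (simp add: field_simps)
      have "\<bar>C - \<kappa> * x\<^sup>2\<bar> \<le> ?R (w((a, 0) := x))"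
        using nrm_step_ge[OF d, of \<kappa> "w((a, 0) := x)" I] square_sum_upd[OF I(1) a, of \<kappa> w x] by (simp add: C_def)
      then have "?R (w((a, 0) := x)) powr - (1/4) \<le> \<bar>C - \<kappa> * x\<^sup>2\<bar> powr - (1/4)"
        using elim by (intro powr_mono2') auto
      also have "\<dots> = \<kappa> powr - (1/4) * \<bar>C / \<kappa> - x\<^sup>2\<bar> powr - (1/4)"
        unfolding eq abs_mult using \<kappa> by (simp add: powr_mult)
      also have "\<dots> \<le> \<kappa> powr - (1/4) * (\<bar>x - r\<bar> powr - (1/2) + \<bar>x + r\<bar> powr - (1/2))"
        unfolding r_def using elim eq \<kappa> by (intro mult_left_mono quarter_powr_le) auto
      finally show ?case
        by (simp add: ennreal_mult'[symmetric] ennreal_plus[symmetric] ennreal_leI del: ennreal_plus)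
    qed
    then have "(\<integral>\<^sup>+x. ennreal (?R (w((a, 0) := x)) powr - (1/4)) \<partial>N)
      \<le> (\<integral>\<^sup>+x. ?c * (ennreal (\<bar>x - r\<bar> powr - (1/2)) + ennreal (\<bar>x - (- r)\<bar> powr - (1/2))) \<partial>N)"
      by (rule nn_integral_mono_AE)
    also have "\<dots> = ?c * ((\<integral>\<^sup>+x. ennreal (\<bar>x - r\<bar> powr - (1/2)) \<partial>N) + (\<integral>\<^sup>+x. ennreal (\<bar>x - (- r)\<bar> powr - (1/2)) \<partial>N))"
      by (subst nn_integral_cmult, simp, subst nn_integral_add) simp_all
    also have "\<dots> \<le> ?c * (K + K)"
      by (intro mult_left_mono add_mono K(2)) simp
    finally show ?thesis .
  qed
  have "moment \<kappa> I d (- (1/4)) = (\<integral>\<^sup>+w. \<integral>\<^sup>+x. ennreal (?R (w((a, 0) := x)) powr - (1/4)) \<partial>N \<partial>P)"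
    unfolding moment_def by (rule nn_integral_resample) measurable
  also have "\<dots> \<le> (\<integral>\<^sup>+w. ?c * (K + K) \<partial>P)"
    by (intro nn_integral_mono inner)
  also have "\<dots> = ?c * (K + K)" by (simp add: D.emeasure_space_1[simplified])
  also have "\<dots> < \<infinity>" using K(1) by (simp add: ennreal_mult_less_top)
  finally show ?thesis .
qed

lemma nrm_step_large:
  assumes d: "d \<ge> 1" and I: "finite I" "I \<noteq> {}" and \<kappa>: "\<kappa> > 0"
  shows "emeasure P {w \<in> space P. nrm d (step \<kappa> I d w (unit_vector 0)) > 2} \<noteq> 0"
proof -
  obtain a where a: "a \<in> I" using I by auto
  \<comment> \<open>The threshold 3 pushes coordinate 0 of the step below 1 - 3 = -2.\<close>
  define F where "F = {x. 3 < \<kappa> * x\<^sup>2}"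
  have "open F" unfolding F_def by (intro open_Collect_less continuous_intros)
  moreover have "sqrt (4 / \<kappa>) \<in> F" using \<kappa> by (simp add: F_def)
  ultimately have "emeasure P {w. \<forall>j\<in>{(a, 0)}. w j \<in> F} \<noteq> 0"
    by (intro box_pos) auto
  moreover have sub: "{w. \<forall>j\<in>{(a, 0)}. w j \<in> F} \<subseteq> {w \<in> space P. nrm d (step \<kappa> I d w (unit_vector 0)) > 2}"
  proof
    fix w :: "nat \<times> nat \<Rightarrow> real" assume "w \<in> {w. \<forall>j\<in>{(a, 0)}. w j \<in> F}"
    then have "3 < \<kappa> * (w (a, 0))\<^sup>2" by (simp add: F_def)
    also have "\<dots> \<le> \<kappa> * (\<Sum>i\<in>I. (w (i, 0))\<^sup>2)"
      using \<kappa> a I member_le_sum[of a I "\<lambda>i. (w (i, 0))\<^sup>2"] by (intro mult_left_mono) auto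
    finally show "w \<in> {w \<in> space P. nrm d (step \<kappa> I d w (unit_vector 0)) > 2}"
      using nrm_step_ge[OF d, of \<kappa> w I] by auto
  qed
  moreover have "{w \<in> space P. nrm d (step \<kappa> I d w (unit_vector 0)) > 2} \<in> sets P"
    by measurable
  ultimately show ?thesis
    using emeasure_mono[OF sub, of P] by auto
qed

lemma positive_rv_step:
  assumes d: "d \<ge> 1" and I: "finite I" "I \<noteq> {}" and \<kappa>: "\<kappa> > 0"
  shows "positive_rv P (\<lambda>w. nrm d (step \<kappa> I d w (unit_vector 0)))"
proof unfold_locales
  let ?R = "\<lambda>w. nrm d (step \<kappa> I d w (unit_vector 0))"
  show [measurable]: "?R \<in> borel_measurable P" by measurable
  show "AE w in P. ?R w > 0" by (rule AE_nrm_step_pos[OF assms])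
  show "emeasure P {w \<in> space P. ?R w > 2} \<noteq> 0" by (rule nrm_step_large[OF assms])
  have int: "integrable P (\<lambda>w. ?R w powr s)" if "moment \<kappa> I d s < \<infinity>" for s
    using that by (intro integrableI_bounded) (auto simp: moment_def)
  fix s :: real assume s: "- (1/4) \<le> s"
  show "integrable P (\<lambda>w. ?R w powr s)"
  proof (cases "s > 0")
    case True
    then show ?thesis by (intro int moment_finite_pos d I \<kappa>)
  next
    case False
    show ?thesis
    proof (rule Bochner_Integration.integrable_bound)
      show "integrable P (\<lambda>w. 1 + ?R w powr - (1/4))"
        using int[OF moment_finite_neg[OF assms]] by simp
      \<comment> \<open>For s between -1/4 and 0 the power is at most 1 from x = 1 on and at most x
        powr - (1/4) below; x = 0 is harmless because 0 powr s = 0.\<close>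
      have "x powr s \<le> 1 + x powr - (1/4)" if "x \<ge> 0" for x :: real
      proof (cases "x \<ge> 1")
        case True
        then have "x powr s \<le> x powr 0" using False by (intro powr_mono) auto
        then show ?thesis using True by (simp add: add_increasing2)
      next
        case lt: False
        then have "x powr s \<le> x powr - (1/4)"
          using s that by (cases "x = 0") (auto intro!: powr_mono')
        then show ?thesis by simp
      qed
      then show "AE w in P. norm (?R w powr s) \<le> norm (1 + ?R w powr - (1/4))"
        by (intro AE_I2) (simp add: order_trans[OF _ abs_ge_self])
    qed simp
  qed
qed

end

section \<open>The functions h and rho\<close>

locale sgd = gaussian_data +
  fixes \<eta> :: real and b d :: nat
  assumes \<eta>_pos: "\<eta> > 0" and b_pos: "b \<ge> 1" and d_pos: "d \<ge> 1"
begin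

definition R :: "(nat \<times> nat \<Rightarrow> real) \<Rightarrow> real" where
  "R w = nrm d (step (\<eta> / real b) {1..b} d w (unit_vector 0))"

sublocale rv: positive_rv P R
  unfolding R_def using \<eta>_pos b_pos d_pos by (intro positive_rv_step) auto

abbreviation X :: "nat \<Rightarrow> nat \<Rightarrow> (nat \<times> nat \<Rightarrow> real) \<Rightarrow> real" where
  "X j k w \<equiv> nrm d (iter (\<eta> / real b) b d w k (unit_vector j))"

lemma moment_eq_g:
  assumes "s \<ge> - (1/4)"
  shows "moment (\<eta> / real b) {1..b} d s = ennreal (rv.g s)"
  unfolding moment_def rv.g_def R_def[symmetric]
  using rv.R_integrable[OF assms] by (intro nn_integral_eq_integral) auto

lemma nn_integral_X_powr:
  assumes "s \<ge> - (1/4)" "j < d"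
  shows "(\<integral>\<^sup>+w. ennreal (X j k w powr s) \<partial>P) = ennreal (rv.g s ^ k)"
proof -
  have "rv.g s \<ge> 0" by (simp add: rv.g_def)
  then show ?thesis
    using assms d_pos
    by (simp only: nn_integral_iter_powr moment_eq_g nrm_unit_vector) (simp add: ennreal_power)
qed

lemma g_pos:
  assumes "s \<ge> - (1/4)"
  shows "rv.g s > 0"
proof -
  have "0 = D.expectation (\<lambda>w. 0)" by simp
  also have "\<dots> < rv.g s"
    unfolding rv.g_def
  proof (rule D.integral_less_AE)
    show "emeasure P (space P) \<noteq> 0" using D.emeasure_space_1 by simp
    show "AE w in P. w \<in> space P \<longrightarrow> 0 \<noteq> R w powr s" using rv.R_pos by eventually_elim simp
    show "space P \<in> sets P" by (rule sets.top)
  qed (use rv.R_integrable[OF assms] in auto)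
  finally show ?thesis .
qed

lemma g_0: "rv.g 0 = 1"
proof -
  have "rv.g 0 = D.expectation (\<lambda>w. 1)"
    unfolding rv.g_def using rv.R_pos by (intro integral_cong_AE) auto
  then show ?thesis using D.prob_space by simp
qed

text \<open>The maximum over columns is enlarged to a sum, because the expectation of each term is
  known exactly.\<close>

lemma spec_powr_le:
  assumes s: "s > 0"
  shows "spec_norm d (Pimat \<eta> b d w k) powr s \<le> sqrt d powr s * (\<Sum>j<d. X j k w powr s)"
proof -
  define c where "c = Max ((\<lambda>j. X j k w) ` {..<d})"
  have ne: "(\<lambda>j. X j k w) ` {..<d} \<noteq> {}" using d_pos by (auto simp: lessThan_empty_iff)
  have "c \<in> (\<lambda>j. X j k w) ` {..<d}" unfolding c_def using ne by (intro Max_in) auto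
  then obtain i where i: "i < d" "c = X i k w" by auto
  have "X j k w \<le> c" if "j < d" for j unfolding c_def using that by (intro Max_ge) auto
  then have "spec_norm d (Pimat \<eta> b d w k) \<le> sqrt d * c"
    using i d_pos by (intro spec_norm_Pimat_le) auto
  then have "spec_norm d (Pimat \<eta> b d w k) powr s \<le> (sqrt d * c) powr s"
    using s d_pos by (intro powr_mono2 spec_norm_nonneg) auto
  also have "\<dots> = sqrt d powr s * X i k w powr s" using i by (simp add: powr_mult)
  also have "\<dots> \<le> sqrt d powr s * (\<Sum>j<d. X j k w powr s)"
    using i member_le_sum[of i "{..<d}" "\<lambda>j. X j k w powr s"] by (intro mult_left_mono) auto
  finally show ?thesis .
qed

lemma spec_moment_bounds:
  assumes s: "s > 0"
  defines "I \<equiv> \<lambda>k. (\<integral>w. spec_norm d (Pimat \<eta> b d w k) powr s \<partial>P)"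
  shows "rv.g s ^ k \<le> I k" "I k \<le> sqrt d powr s * d * rv.g s ^ k"
proof -
  have [measurable]: "(\<lambda>w. spec_norm d (Pimat \<eta> b d w k)) \<in> borel_measurable P"
    by (rule measurable_spec_norm[OF d_pos])
  let ?n = "\<integral>\<^sup>+w. ennreal (spec_norm d (Pimat \<eta> b d w k) powr s) \<partial>P"
  have g: "rv.g s \<ge> 0" by (simp add: rv.g_def)
  have "?n \<le> (\<integral>\<^sup>+w. ennreal (sqrt d powr s) * (\<Sum>j<d. ennreal (X j k w powr s)) \<partial>P)"
    by (intro nn_integral_mono)
       (simp add: sum_ennreal ennreal_mult'[symmetric] sum_nonneg ennreal_leI spec_powr_le[OF s])
  also have "\<dots> = ennreal (sqrt d powr s) * (\<Sum>j<d. \<integral>\<^sup>+w. ennreal (X j k w powr s) \<partial>P)"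
    by (subst nn_integral_cmult, measurable, subst nn_integral_sum) auto
  also have "\<dots> = ennreal (sqrt d powr s * d * rv.g s ^ k)"
    using s g by (simp add: nn_integral_X_powr ennreal_mult' ennreal_of_nat_eq_real_of_nat mult.assoc)
  finally have upper: "?n \<le> ennreal (sqrt d powr s * d * rv.g s ^ k)" .
  \<comment> \<open>Finiteness has to precede the lower bound: the Bochner integral in
    \<open>hfun\<close> would be 0 for a function that is not integrable.\<close>
  then have "?n < \<infinity>" by (rule order_le_less_trans) simp
  then have "integrable P (\<lambda>w. spec_norm d (Pimat \<eta> b d w k) powr s)"
    by (intro integrableI_bounded) auto
  then have n: "?n = ennreal (I k)"
    unfolding I_def by (intro nn_integral_eq_integral) auto
  have "I k \<ge> 0" by (simp add: I_def)
  then show "I k \<le> sqrt d powr s * d * rv.g s ^ k"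
    using upper g unfolding n by (simp add: ennreal_le_iff)
  have "ennreal (rv.g s ^ k) = (\<integral>\<^sup>+w. ennreal (X 0 k w powr s) \<partial>P)"
    using s d_pos by (subst nn_integral_X_powr) auto
  also have "\<dots> \<le> ?n"
    using s d_pos by (intro nn_integral_mono ennreal_leI powr_mono2 spec_norm_Pimat_ge) auto
  finally show "rv.g s ^ k \<le> I k"
    unfolding n using \<open>I k \<ge> 0\<close> by (simp add: ennreal_le_iff)
qed

text \<open>The moments of the norm lie between g s ^ k and a constant times it, and the k-th root
  sends the constant to 1.\<close>

lemma hfun_eq:
  assumes s: "s > 0"
  shows "hfun \<eta> v b d s = rv.g s"
  unfolding hfun_def
proof (rule limI)
  let ?I = "\<lambda>k. (\<integral>w. spec_norm d (Pimat \<eta> b d w k) powr s \<partial>P)"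
  define C where "C = sqrt d powr s * d"
  have g: "rv.g s > 0" using s by (intro g_pos) simp
  have C: "C > 0" using d_pos by (simp add: C_def)
  have root: "(rv.g s ^ k) powr (1 / real k) = rv.g s" if "k > 0" for k
    using g that by (simp add: powr_realpow[symmetric] powr_powr)
  show "(\<lambda>k. ?I k powr (1 / real k)) \<longlonglongrightarrow> rv.g s"
  proof (rule real_tendsto_sandwich[of "\<lambda>_. rv.g s" _ _ "\<lambda>k. C powr (1 / real k) * rv.g s"])
    show "\<forall>\<^sub>F k in sequentially. rv.g s \<le> ?I k powr (1 / real k)"
      using eventually_gt_at_top[of 0]
    proof eventually_elim
      case (elim k)
      have "(rv.g s ^ k) powr (1 / real k) \<le> ?I k powr (1 / real k)"
        using g spec_moment_bounds(1)[OF s, of k] by (intro powr_mono2) auto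
      then show ?case using root[OF elim] by simp
    qed
    show "\<forall>\<^sub>F k in sequentially. ?I k powr (1 / real k) \<le> C powr (1 / real k) * rv.g s"
      using eventually_gt_at_top[of 0]
    proof eventually_elim
      case (elim k)
      have "0 \<le> ?I k" by simp
      then have "?I k powr (1 / real k) \<le> (C * rv.g s ^ k) powr (1 / real k)"
        using spec_moment_bounds(2)[OF s, of k] unfolding C_def by (intro powr_mono2) auto
      also have "\<dots> = C powr (1 / real k) * rv.g s"
        using root[OF elim] by (simp add: powr_mult)
      finally show ?case .
    qed
    have "(\<lambda>k. C powr (1 / real k)) \<longlonglongrightarrow> C powr 0"
      using C by (intro tendsto_powr tendsto_const lim_1_over_n) auto
    then show "(\<lambda>k. C powr (1 / real k) * rv.g s) \<longlonglongrightarrow> rv.g s"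
      using C tendsto_mult[of "\<lambda>k. C powr (1 / real k)" 1 sequentially "\<lambda>_. rv.g s" "rv.g s"] by simp
  qed simp
qed

section \<open>Almost sure growth rate of the products\<close>

lemma markov_eventually:
  assumes j: "j < d" and s: "s \<ge> - (1/4)" and c: "rv.g s < c"
  shows "AE w in P. \<forall>\<^sub>F k in sequentially. X j k w powr s < c ^ k"
proof -
  have g: "rv.g s \<ge> 0" by (simp add: rv.g_def)
  then have c0: "c > 0" using c by simp
  \<comment> \<open>The moment equals g s ^ k exactly, so Markov's inequality bounds the probability
    of \<open>A k\<close> by (g s / c)^k, which is summable as Borel-Cantelli demands.\<close>
  define A where "A k = {w \<in> space P. c ^ k \<le> X j k w powr s}" for k
  have A [measurable]: "A k \<in> sets P" for k unfolding A_def by measurable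
  have bound: "emeasure P (A k) \<le> ennreal ((rv.g s / c) ^ k)" for k
  proof -
    have "A k = {w \<in> space P. 1 \<le> ennreal (1 / c ^ k) * ennreal (X j k w powr s)}"
      using c0 by (auto simp: A_def ennreal_mult'[symmetric] ennreal_ge_1 field_simps)
    then have "emeasure P (A k) \<le> ennreal (1 / c ^ k) * (\<integral>\<^sup>+w. ennreal (X j k w powr s) * indicator (space P) w \<partial>P)"
      using nn_integral_Markov_inequality[of "\<lambda>w. ennreal (X j k w powr s)" "space P" P "ennreal (1 / c ^ k)"]
        sets.top[of P] by simp
    also have "\<dots> = ennreal (1 / c ^ k) * ennreal (rv.g s ^ k)"
      using nn_integral_X_powr[OF s j] by simp
    also have "\<dots> = ennreal ((rv.g s / c) ^ k)"
      using c0 by (simp add: ennreal_mult'[symmetric] power_divide)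
    finally show ?thesis .
  qed
  have "summable (\<lambda>k. measure P (A k))"
  proof (rule summable_comparison_test)
    show "summable (\<lambda>k. (rv.g s / c) ^ k)"
      using g c c0 by (intro summable_geometric) simp
    have "measure P (A k) \<le> (rv.g s / c) ^ k" for k
      using bound[of k] g c0 by (simp add: D.emeasure_eq_measure ennreal_le_iff)
    then show "\<exists>N. \<forall>k\<ge>N. norm (measure P (A k)) \<le> (rv.g s / c) ^ k" by auto
  qed
  then have "AE w in P. \<forall>\<^sub>F k in sequentially. w \<in> space P - A k"
    by (intro borel_cantelli_AE1) (auto simp: D.emeasure_eq_measure)
  then show ?thesis
    by eventually_elim (auto simp: A_def not_le elim: eventually_mono)
qed

text \<open>The product formula at s = 0: since x powr 0 is 1 for x > 0 and 0 for x = 0, the moment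
  of order 0 is the probability of being positive.\<close>

lemma AE_X_pos: "AE w in P. \<forall>k. X 0 k w > 0"
  unfolding AE_all_countable
proof
  fix k
  have "emeasure P {w \<in> space P. X 0 k w > 0} = (\<integral>\<^sup>+w. ennreal (X 0 k w powr 0) \<partial>P)"
    by (subst nn_integral_indicator[symmetric], measurable)
       (auto intro!: nn_integral_cong simp: indicator_def less_le)
  also have "\<dots> = 1"
    using d_pos by (subst nn_integral_X_powr) (auto simp: g_0)
  finally show "AE w in P. X 0 k w > 0"
    by (subst D.AE_iff_emeasure_eq_1) auto
qed

lemma AE_X_upper:
  assumes "j < d" "\<epsilon> > 0"
  shows "AE w in P. \<forall>\<^sub>F k in sequentially. X j k w \<le> exp (real k * (rv.\<gamma> + \<epsilon>))"
proof -
  obtain s where s: "0 < s" "rv.g s < exp (s * (rv.\<gamma> + \<epsilon>))" using rv.g_upper[OF assms(2)] by blast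
  have "AE w in P. \<forall>\<^sub>F k in sequentially. X j k w powr s < exp (s * (rv.\<gamma> + \<epsilon>)) ^ k"
    using assms s by (intro markov_eventually) auto
  then show ?thesis
  proof eventually_elim
    case (elim w)
    then show ?case
    proof eventually_elim
      case (elim k)
      have "X j k w powr s < exp (real k * (rv.\<gamma> + \<epsilon>)) powr s"
        using elim by (simp add: powr_def exp_of_nat_mult[symmetric] ac_simps)
      then show ?case using s(1) by (meson exp_ge_zero le_less_linear less_le_not_le powr_mono2 less_imp_le)
    qed
  qed
qed

text \<open>A negative exponent turns an upper bound on the moment into a lower bound on X.
  Positivity of X is essential, since 0 powr - s = 0 would satisfy the bound as well.\<close>

lemma AE_X_lower:
  assumes "\<epsilon> > 0"
  shows "AE w in P. \<forall>\<^sub>F k in sequentially. exp (real k * (rv.\<gamma> - \<epsilon>)) \<le> X 0 k w"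
proof -
  obtain s where s: "0 < s" "s \<le> 1/4" "rv.g (- s) < exp (- s * (rv.\<gamma> - \<epsilon>))" using rv.g_lower[OF assms] by blast
  have "AE w in P. \<forall>\<^sub>F k in sequentially. X 0 k w powr - s < exp (- s * (rv.\<gamma> - \<epsilon>)) ^ k"
    using d_pos s by (intro markov_eventually) auto
  then show ?thesis
    using AE_X_pos
  proof eventually_elim
    case (elim w)
    from elim(1) show ?case
    proof eventually_elim
      case (elim k)
      have lt: "X 0 k w powr - s < exp (real k * (rv.\<gamma> - \<epsilon>)) powr - s"
        using elim by (simp add: powr_def exp_of_nat_mult[symmetric] ac_simps)
      show ?case
      proof (rule ccontr)
        assume "\<not> exp (real k * (rv.\<gamma> - \<epsilon>)) \<le> X 0 k w"
        then have "exp (real k * (rv.\<gamma> - \<epsilon>)) powr - s \<le> X 0 k w powr - s"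
          using s(1) \<open>\<forall>k. 0 < X 0 k w\<close> by (intro powr_mono2') auto
        then show False using lt by simp
      qed
    qed
  qed
qed

lemma AE_lyapunov:
  "AE w in P. (\<lambda>k. ln (lambda_max (transpose_mat (Pimat \<eta> b d w k) * Pimat \<eta> b d w k)) / (2 * real k))
     \<longlonglongrightarrow> rv.\<gamma>"
proof -
  \<comment> \<open>The tolerance runs through 1 / (n + 1), so that only countably many exceptional
    null sets occur.\<close>
  have "AE w in P. \<forall>n. \<forall>j\<in>{..<d}. \<forall>\<^sub>F k in sequentially. X j k w \<le> exp (real k * (rv.\<gamma> + 1 / real (Suc n)))"
    unfolding AE_all_countable by (intro allI AE_finite_allI AE_X_upper) auto
  moreover have "AE w in P. \<forall>n. \<forall>\<^sub>F k in sequentially. exp (real k * (rv.\<gamma> - 1 / real (Suc n))) \<le> X 0 k w"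
    unfolding AE_all_countable by (intro allI AE_X_lower) auto
  ultimately show ?thesis
  proof eventually_elim
    case (elim w)
    let ?\<sigma> = "\<lambda>k. spec_norm d (Pimat \<eta> b d w k)"
    have lam: "ln (lambda_max (transpose_mat (Pimat \<eta> b d w k) * Pimat \<eta> b d w k)) / (2 * real k) = ln (?\<sigma> k) / real k"
      if "?\<sigma> k > 0" for k
      using that by (simp add: lambda_max_gram[OF Pimat_carrier d_pos] ln_realpow)
    show ?case
    proof (rule LIMSEQ_I)
      fix r :: real assume r: "r > 0"
      obtain n where n: "1 / real (Suc n) < r / 2"
        using reals_Archimedean[of "r / 2"] r by (auto simp: inverse_eq_divide)
      define \<epsilon> where "\<epsilon> = 1 / real (Suc n)"
      have up: "\<forall>\<^sub>F k in sequentially. \<forall>j\<in>{..<d}. X j k w \<le> exp (real k * (rv.\<gamma> + \<epsilon>))"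
        using elim(1) by (intro eventually_ball_finite) (auto simp: \<epsilon>_def)
      have lo: "\<forall>\<^sub>F k in sequentially. exp (real k * (rv.\<gamma> - \<epsilon>)) \<le> X 0 k w"
        using elim(2) by (auto simp: \<epsilon>_def)
      have "(\<lambda>k. ln (sqrt d) / real k) \<longlonglongrightarrow> 0" by (rule lim_const_over_n)
      then have small: "\<forall>\<^sub>F k in sequentially. ln (sqrt d) / real k < r / 2"
        using r by (intro order_tendstoD(2)) auto
      have "\<forall>\<^sub>F k in sequentially. norm (ln (lambda_max (transpose_mat (Pimat \<eta> b d w k) * Pimat \<eta> b d w k)) / (2 * real k) - rv.\<gamma>) < r"
        using up lo small eventually_gt_at_top[of 0]
      proof eventually_elim
        case (elim k)
        have "exp (real k * (rv.\<gamma> - \<epsilon>)) \<le> ?\<sigma> k"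
          using elim(2) spec_norm_Pimat_ge[of 0 d \<eta> b w k] d_pos by linarith
        moreover from this have pos: "?\<sigma> k > 0" by (meson exp_gt_zero less_le_trans)
        ultimately have "real k * (rv.\<gamma> - \<epsilon>) \<le> ln (?\<sigma> k)" by (simp add: ln_ge_iff)
        then have low: "rv.\<gamma> - \<epsilon> \<le> ln (?\<sigma> k) / real k"
          using elim(4) by (simp add: pos_le_divide_eq mult.commute)
        have "?\<sigma> k \<le> sqrt d * exp (real k * (rv.\<gamma> + \<epsilon>))"
          using elim(1) d_pos by (intro spec_norm_Pimat_le) auto
        then have "ln (?\<sigma> k) \<le> ln (sqrt d * exp (real k * (rv.\<gamma> + \<epsilon>)))"
          using pos by simp
        also have "\<dots> = ln (sqrt d) + real k * (rv.\<gamma> + \<epsilon>)"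
          using d_pos by (subst ln_mult) auto
        finally have "ln (?\<sigma> k) / real k \<le> ln (sqrt d) / real k + (rv.\<gamma> + \<epsilon>)"
          using elim(4) by (simp add: field_simps)
        then show ?case
          unfolding lam[OF pos] real_norm_def using low elim(3) n[folded \<epsilon>_def] by linarith
      qed
      then show "\<exists>no. \<forall>k\<ge>no. norm (ln (lambda_max (transpose_mat (Pimat \<eta> b d w k) * Pimat \<eta> b d w k)) / (2 * real k) - rv.\<gamma>) < r"
        by (simp add: eventually_sequentially)
    qed
  qed
qed

text \<open>Any other candidate limit agrees with \<gamma> almost surely, and on a probability space
  a constant statement that holds almost surely is true.\<close>

lemma rho_eq: "rho \<eta> v b d = rv.\<gamma>"
  unfolding rho_def
proof (rule the_equality)
  show "AE w in P. (\<lambda>k. ln (lambda_max (transpose_mat (Pimat \<eta> b d w k) * Pimat \<eta> b d w k)) / (2 * real k)) \<longlonglongrightarrow> rv.\<gamma>"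
    by (rule AE_lyapunov)
  fix r assume "AE w in P. (\<lambda>k. ln (lambda_max (transpose_mat (Pimat \<eta> b d w k) * Pimat \<eta> b d w k)) / (2 * real k)) \<longlonglongrightarrow> r"
  with AE_lyapunov have "AE w in P. r = rv.\<gamma>"
    by eventually_elim (rule LIMSEQ_unique)
  then show "r = rv.\<gamma>" by (simp add: D.AE_const)
qed

text \<open>\<open>hfun\<close> and g agree at positive exponents, so the two definite descriptions
  coincide, and the sign of \<open>rho\<close> makes the second one well defined.\<close>

lemma tail_index_root:
  assumes "admissible \<eta> v b d"
  shows "tail_index \<eta> v b d > 0" "rv.g (tail_index \<eta> v b d) = 1"
proof -
  have "rv.\<gamma> < 0" using assms by (simp add: admissible_def rho_eq)
  then have ex: "\<exists>!\<alpha>. \<alpha> > 0 \<and> rv.g \<alpha> = 1" by (rule rv.ex1_root)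
  have eq: "tail_index \<eta> v b d = (THE \<alpha>. \<alpha> > 0 \<and> rv.g \<alpha> = 1)"
    unfolding tail_index_def by (rule arg_cong[where f=The]) (auto simp: hfun_eq fun_eq_iff)
  show "tail_index \<eta> v b d > 0" "rv.g (tail_index \<eta> v b d) = 1"
    using theI'[OF ex] by (simp_all add: eq)
qed

end

section \<open>Monotonicity of the tail-index\<close>

lemma nrm_triangle: "nrm d (\<lambda>r. x r + y r) \<le> nrm d x + nrm d y"
  unfolding nrm_def by (rule L2_set_triangle_ineq)

lemma nrm_sum_le: "nrm d (\<lambda>r. \<Sum>j\<in>J. u j r) \<le> (\<Sum>j\<in>J. nrm d (u j))"
proof (induction J rule: infinite_finite_induct)
  case (insert j J)
  then show ?case using nrm_triangle[of d "u j" "\<lambda>r. \<Sum>j\<in>J. u j r"] by simp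
qed (simp_all add: nrm_def L2_set_def)

text \<open>Opposite signs in one coordinate lower the inner product strictly below the sum of
  absolute products, so the Cauchy-Schwarz bound is strict.\<close>

lemma nrm_triangle_strict:
  assumes r: "r < d" and x: "x r > 0" and y: "y r < 0"
  shows "nrm d (\<lambda>r. x r + y r) < nrm d x + nrm d y"
proof (rule power2_less_imp_less)
  have "(\<Sum>r<d. x r * y r) < (\<Sum>r<d. \<bar>x r\<bar> * \<bar>y r\<bar>)"
  proof (rule sum_strict_mono_ex1)
    show "\<forall>i\<in>{..<d}. x i * y i \<le> \<bar>x i\<bar> * \<bar>y i\<bar>"
    proof
      fix i
      show "x i * y i \<le> \<bar>x i\<bar> * \<bar>y i\<bar>" using abs_ge_self[of "x i * y i"] by (simp only: abs_mult)
    qed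
    have "x r * y r < 0" using x y by (rule mult_pos_neg)
    also have "0 \<le> \<bar>x r\<bar> * \<bar>y r\<bar>" by simp
    finally have "x r * y r < \<bar>x r\<bar> * \<bar>y r\<bar>" .
    then show "\<exists>i\<in>{..<d}. x i * y i < \<bar>x i\<bar> * \<bar>y i\<bar>" using r by auto
  qed simp
  also have "\<dots> \<le> nrm d x * nrm d y" unfolding nrm_def by (rule L2_set_mult_ineq)
  finally have "(\<Sum>r<d. x r * y r) < nrm d x * nrm d y" .
  moreover have "(nrm d (\<lambda>r. x r + y r))\<^sup>2 = (nrm d x)\<^sup>2 + (nrm d y)\<^sup>2 + 2 * (\<Sum>r<d. x r * y r)"
    by (simp add: nrm_power2 power2_sum sum.distrib sum_distrib_left mult.assoc)
  ultimately show "(nrm d (\<lambda>r. x r + y r))\<^sup>2 < (nrm d x + nrm d y)\<^sup>2"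
    by (simp add: power2_sum)
qed simp

lemma nrm_sum_strict:
  assumes J: "finite J" "a \<in> J" "c \<in> J" and r: "r < d" and a: "u a r > 0" and c: "u c r < 0"
  shows "nrm d (\<lambda>r. \<Sum>j\<in>J. u j r) < (\<Sum>j\<in>J. nrm d (u j))"
proof -
  have ac: "a \<noteq> c" using a c by auto
  have split: "(\<Sum>j\<in>J. f j) = f a + f c + (\<Sum>j\<in>J - {a} - {c}. f j)" for f :: "'a \<Rightarrow> real"
    using J ac by (subst sum.remove[of J a], simp, simp, subst sum.remove[of _ c]) auto
  have "nrm d (\<lambda>r. \<Sum>j\<in>J. u j r)
      \<le> nrm d (\<lambda>r. u a r + u c r) + nrm d (\<lambda>r. \<Sum>j\<in>J - {a} - {c}. u j r)"
    unfolding split by (rule nrm_triangle)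
  also have "\<dots> < nrm d (u a) + nrm d (u c) + (\<Sum>j\<in>J - {a} - {c}. nrm d (u j))"
    by (intro add_less_le_mono nrm_triangle_strict[OF r] nrm_sum_le a c)
  finally show ?thesis by (simp only: split[of "\<lambda>j. nrm d (u j)"])
qed

section \<open>Strict comparison of the moments of a step\<close>

context gaussian_data
begin

definition step_moment :: "real \<Rightarrow> nat set \<Rightarrow> nat \<Rightarrow> real \<Rightarrow> real" where
  "step_moment \<kappa> I d s = D.expectation (\<lambda>w. nrm d (step \<kappa> I d w (unit_vector 0)) powr s)"

lemma integrable_step:
  assumes "d \<ge> 1" "finite I" "I \<noteq> {}" "\<kappa> > 0" "s > 0"
  shows "integrable P (\<lambda>w. nrm d (step \<kappa> I d w (unit_vector 0)) powr s)"
  using positive_rv.R_integrable[OF positive_rv_step[OF assms(1-4)], of s] assms(5) by simp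

lemma step_moment_eq: "step_moment \<kappa> I d s = enn2real (moment \<kappa> I d s)"
  unfolding step_moment_def moment_def by (rule integral_eq_nn_integral) simp_all

lemma step_moment_reindex: "inj \<pi> \<Longrightarrow> step_moment \<kappa> (\<pi> ` I) d s = step_moment \<kappa> I d s"
  by (simp add: step_moment_eq moment_reindex)

text \<open>The sample space is the same for all dimensions, so both norms are read off one sample
  and differ by the squares of the coordinates from d1 to d2 - 1.\<close>

lemma step_moment_dim:
  assumes d: "1 \<le> d1" "d1 < d2" and I: "finite I" "I \<noteq> {}" and \<kappa>: "\<kappa> > 0" and s: "s > 0"
  shows "step_moment \<kappa> I d1 s < step_moment \<kappa> I d2 s"
proof -
  define u where "u w p = unit_vector 0 p - \<kappa> * (\<Sum>i\<in>I. w (i, p) * w (i, 0))" for w :: "nat \<times> nat \<Rightarrow> real" and p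
  have u: "step \<kappa> I d w (unit_vector 0) = u w" if "d \<ge> 1" for d w
    by (rule ext) (simp add: u_def step_unit_vector[OF that])
  have int: "integrable P (\<lambda>w. nrm d (u w) powr s)" if "d \<ge> 1" for d
    using integrable_step[OF that I \<kappa> s] u[OF that] by simp
  have split: "(nrm d2 y)\<^sup>2 = (nrm d1 y)\<^sup>2 + (\<Sum>p\<in>{d1..<d2}. (y p)\<^sup>2)" for y
    unfolding nrm_power2 using d by (simp add: lessThan_atLeast0 sum.atLeastLessThan_concat)
  \<comment> \<open>Positive entries make the sum of the products w (i, d1) * w (i, 0) positive, so
    the added coordinate d1 is nonzero.\<close>
  define A where "A = {w :: nat \<times> nat \<Rightarrow> real. \<forall>j\<in>I \<times> {0, d1}. w j \<in> {0<..}}"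
  have "D.expectation (\<lambda>w. nrm d1 (u w) powr s) < D.expectation (\<lambda>w. nrm d2 (u w) powr s)"
  proof (rule D.integral_less_AE)
    show "integrable P (\<lambda>w. nrm d1 (u w) powr s)" "integrable P (\<lambda>w. nrm d2 (u w) powr s)"
      using d by (auto intro!: int)
    show "emeasure P A \<noteq> 0" unfolding A_def using I by (intro box_pos) (auto simp: gt_ex)
    show "A \<in> sets P" unfolding A_def using I by (intro box_sets) auto
    show "AE w in P. nrm d1 (u w) powr s \<le> nrm d2 (u w) powr s"
    proof (intro AE_I2 powr_mono2)
      fix w
      have "(nrm d1 (u w))\<^sup>2 \<le> (nrm d2 (u w))\<^sup>2" unfolding split by (simp add: sum_nonneg)
      then show "nrm d1 (u w) \<le> nrm d2 (u w)" by (rule power2_le_imp_le) simp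
    qed (use s in auto)
    show "AE w in P. w \<in> A \<longrightarrow> nrm d1 (u w) powr s \<noteq> nrm d2 (u w) powr s"
    proof (intro AE_I2 impI)
      fix w assume w: "w \<in> A"
      have "(\<Sum>i\<in>I. w (i, d1) * w (i, 0)) > 0"
        using w I by (intro sum_pos) (auto simp: A_def)
      then have "u w d1 < 0" using \<kappa> d by (simp add: u_def unit_vector_def)
      then have "0 < (u w d1)\<^sup>2" by simp
      also have "\<dots> \<le> (\<Sum>p\<in>{d1..<d2}. (u w p)\<^sup>2)" using d by (intro member_le_sum) auto
      finally have "(nrm d1 (u w))\<^sup>2 < (nrm d2 (u w))\<^sup>2" unfolding split by simp
      then have "nrm d1 (u w) < nrm d2 (u w)" by (rule power2_less_imp_less) simp
      then have "nrm d1 (u w) powr s < nrm d2 (u w) powr s" using s by (intro powr_less_mono2) auto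
      then show "nrm d1 (u w) powr s \<noteq> nrm d2 (u w) powr s" by simp
    qed
  qed
  then show ?thesis using d by (simp add: step_moment_def u)
qed

text \<open>The step with \<kappa>1 is the convex combination, with weight t, of the step with
  \<kappa>2 and the unmoved unit vector of norm 1. The claim is strict convexity along the chord
  from \<kappa> = 0.\<close>

lemma step_moment_stepsize:
  assumes d: "d \<ge> 1" and I: "finite I" "I \<noteq> {}" and \<kappa>: "0 < \<kappa>1" "\<kappa>1 < \<kappa>2" and s: "s \<ge> 1"
  defines "t \<equiv> \<kappa>1 / \<kappa>2"
  shows "step_moment \<kappa>1 I d s < t * step_moment \<kappa>2 I d s + (1 - t)"
proof -
  let ?u = "\<lambda>\<kappa> w. step \<kappa> I d w (unit_vector 0)"
  let ?R = "\<lambda>\<kappa> w. nrm d (?u \<kappa> w)"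
  have t: "0 < t" "t < 1" using \<kappa> by (auto simp: t_def)
  have \<kappa>2: "\<kappa>2 > 0" using \<kappa> by simp
  have int: "integrable P (\<lambda>w. ?R \<kappa> w powr s)" if "\<kappa> > 0" for \<kappa>
    using s by (intro integrable_step[OF d I that]) simp
  have comb: "?u \<kappa>1 w = (\<lambda>r. t * ?u \<kappa>2 w r + (1 - t) * unit_vector 0 r)" for w
  proof -
    have "\<kappa>1 = t * \<kappa>2" using \<kappa> by (simp add: t_def)
    then show ?thesis by (simp add: step_unit_vector[OF d] fun_eq_iff algebra_simps)
  qed
  have e: "nrm d (\<lambda>r. (1 - t) * unit_vector 0 r) = 1 - t"
    using d t by (simp add: nrm_cmult nrm_unit_vector)
  have le: "?R \<kappa>1 w \<le> t * ?R \<kappa>2 w + (1 - t)" for w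
    unfolding comb using nrm_triangle[of d "\<lambda>r. t * ?u \<kappa>2 w r" "\<lambda>r. (1 - t) * unit_vector 0 r"] t
    by (simp add: nrm_cmult[of d t] e)
  obtain a where a: "a \<in> I" using I by auto
  \<comment> \<open>One large entry makes coordinate 0 of the \<kappa>2-step negative, opposite to
    that of the unit vector, so the triangle inequality is strict.\<close>
  define A where "A = {w :: nat \<times> nat \<Rightarrow> real. \<forall>j\<in>{(a, 0)}. w j \<in> {x. 1 < \<kappa>2 * x\<^sup>2}}"
  have op: "open {x. 1 < \<kappa>2 * x\<^sup>2}" by (intro open_Collect_less continuous_intros)
  have ne: "sqrt (2 / \<kappa>2) \<in> {x. 1 < \<kappa>2 * x\<^sup>2}" using \<kappa>2 by simp
  have lt: "?R \<kappa>1 w < t * ?R \<kappa>2 w + (1 - t)" if "w \<in> A" for w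
  proof -
    have "1 < \<kappa>2 * (w (a, 0))\<^sup>2" using that by (simp add: A_def)
    also have "\<dots> \<le> \<kappa>2 * (\<Sum>i\<in>I. (w (i, 0))\<^sup>2)"
      using \<kappa>2 a I member_le_sum[of a I "\<lambda>i. (w (i, 0))\<^sup>2"] by (intro mult_left_mono) auto
    finally have neg: "?u \<kappa>2 w 0 < 0" by (simp add: step_unit_vector[OF d] power2_eq_square)
    have "nrm d (\<lambda>r. (1 - t) * unit_vector 0 r + t * ?u \<kappa>2 w r)
        < nrm d (\<lambda>r. (1 - t) * unit_vector 0 r) + nrm d (\<lambda>r. t * ?u \<kappa>2 w r)"
      using d t neg by (intro nrm_triangle_strict[of 0]) (auto intro: mult_pos_neg)
    then show ?thesis
      unfolding comb e using t by (simp add: nrm_cmult[of d t] add.commute)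
  qed
  have conv: "(t * x + (1 - t)) powr s \<le> t * x powr s + (1 - t)" if "x > 0" for x
    using convex_onD[OF powr_convex[OF s], of t 1 x] that t by (simp add: add.commute)
  have pos: "AE w in P. ?R \<kappa>2 w > 0" by (rule AE_nrm_step_pos[OF d I \<kappa>2])
  have "step_moment \<kappa>1 I d s < D.expectation (\<lambda>w. t * ?R \<kappa>2 w powr s + (1 - t))"
    unfolding step_moment_def
  proof (rule D.integral_less_AE)
    show "integrable P (\<lambda>w. ?R \<kappa>1 w powr s)" using \<kappa> by (intro int) simp
    show "integrable P (\<lambda>w. t * ?R \<kappa>2 w powr s + (1 - t))" using int[OF \<kappa>2] by simp
    show "emeasure P A \<noteq> 0" unfolding A_def using op ne by (intro box_pos) auto
    show "A \<in> sets P" unfolding A_def using op by (intro box_sets) auto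
    show "AE w in P. ?R \<kappa>1 w powr s \<le> t * ?R \<kappa>2 w powr s + (1 - t)"
      using pos
    proof eventually_elim
      case (elim w)
      have "?R \<kappa>1 w powr s \<le> (t * ?R \<kappa>2 w + (1 - t)) powr s" using s le by (intro powr_mono2) auto
      then show ?case using conv[OF elim] by linarith
    qed
    show "AE w in P. w \<in> A \<longrightarrow> ?R \<kappa>1 w powr s \<noteq> t * ?R \<kappa>2 w powr s + (1 - t)"
    proof -
      have "?R \<kappa>1 w powr s \<noteq> t * ?R \<kappa>2 w powr s + (1 - t)" if "?R \<kappa>2 w > 0" "w \<in> A" for w
      proof -
        have "?R \<kappa>1 w powr s < (t * ?R \<kappa>2 w + (1 - t)) powr s"
          using s lt[OF that(2)] by (intro powr_less_mono2) auto
        then show ?thesis using conv[OF that(1)] by linarith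
      qed
      then show ?thesis using pos by (auto elim: eventually_mono)
    qed
  qed
  also have "\<dots> = t * step_moment \<kappa>2 I d s + (1 - t)"
    using int[OF \<kappa>2] D.prob_space by (simp add: step_moment_def)
  finally show ?thesis .
qed

text \<open>The average over a batch of size b + 1 is the mean of the b + 1 leave-one-out averages,
  each of which has the law of an average over a batch of size b.\<close>

lemma step_moment_batch_Suc:
  assumes d: "d \<ge> 1" and b: "b \<ge> 1" and \<eta>: "\<eta> > 0" and s: "s \<ge> 1"
  shows "step_moment (\<eta> / real (Suc b)) {1..Suc b} d s < step_moment (\<eta> / real b) {1..b} d s"
proof -
  define J where "J = {1..Suc b}"
  define n where "n = real (Suc b)"
  define \<kappa> where "\<kappa> = \<eta> / real b"
  let ?u = "\<lambda>j w. step \<kappa> (J - {j}) d w (unit_vector 0)"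
  let ?U = "\<lambda>w. step (\<eta> / real (Suc b)) J d w (unit_vector 0)"
  let ?R = "\<lambda>j w. nrm d (?u j w)"
  have J: "finite J" "card J = Suc b" "1 \<in> J" "Suc b \<in> J" "J \<noteq> {}" by (auto simp: J_def)
  have n: "n > 0" by (simp add: n_def)
  have \<kappa>: "\<kappa> > 0" using \<eta> b by (simp add: \<kappa>_def)
  have ne: "J - {j} \<noteq> {}" for j
  proof -
    have "1 \<in> J" "2 \<in> J" using b by (auto simp: J_def)
    then show ?thesis by (cases "j = 1") auto
  qed
  have int: "integrable P (\<lambda>w. ?R j w powr s)" for j
    using s by (intro integrable_step[OF d _ ne \<kappa>]) (auto simp: J_def)
  have intU: "integrable P (\<lambda>w. nrm d (?U w) powr s)"
    using s \<eta> by (intro integrable_step[OF d]) (auto simp: J_def)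
  have law: "step_moment \<kappa> (J - {j}) d s = step_moment \<kappa> {1..b} d s" if "j \<in> J" for j
  proof -
    \<comment> \<open>{1..b} is J without Suc b, and exchanging j with Suc b moves the gap to j. A
      transposition is injective on all indices, as relabelling requires.\<close>
    have "Transposition.transpose j (Suc b) ` {1..b} = J - {j}"
    proof -
      have "{1..b} = J - {Suc b}" by (auto simp: J_def)
      then have "Transposition.transpose j (Suc b) ` {1..b} = Transposition.transpose j (Suc b) ` J - {j}"
        by (simp only: image_set_diff[OF inj_transpose]) simp
      then show ?thesis using that J(4) by simp
    qed
    then show ?thesis using step_moment_reindex[of "Transposition.transpose j (Suc b)" \<kappa> "{1..b}" d s] by simp
  qed
  \<comment> \<open>Each row belongs to b of the b + 1 leave-one-out sets, and \<kappa> * b =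
    \<eta>.\<close>
  have avg: "?U w = (\<lambda>r. (1 / n) * (\<Sum>j\<in>J. ?u j w r))" for w
  proof
    fix r
    define y where "y i = w (i, r) * w (i, 0)" for i
    have "(\<Sum>j\<in>J. \<Sum>i\<in>J - {j}. y i) = (\<Sum>j\<in>J. (\<Sum>i\<in>J. y i) - y j)"
      using J by (intro sum.cong) (auto simp: sum_diff1)
    also have "\<dots> = real b * (\<Sum>i\<in>J. y i)"
      using J by (simp add: sum_subtractf algebra_simps)
    finally have "(\<Sum>j\<in>J. ?u j w r) = n * unit_vector 0 r - \<kappa> * (real b * (\<Sum>i\<in>J. y i))"
      using J by (simp add: step_unit_vector[OF d] sum_subtractf sum_distrib_left[symmetric] y_def n_def)
    also have "\<kappa> * (real b * (\<Sum>i\<in>J. y i)) = \<eta> * (\<Sum>i\<in>J. y i)" using b by (simp add: \<kappa>_def)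
    finally show "?U w r = (1 / n) * (\<Sum>j\<in>J. ?u j w r)"
      using n by (simp add: step_unit_vector[OF d] y_def n_def field_simps)
  qed
  have le: "nrm d (?U w) \<le> (\<Sum>j\<in>J. (1 / n) * ?R j w)" for w
    unfolding avg nrm_cmult sum_distrib_left[symmetric] using n nrm_sum_le[of d "\<lambda>j. ?u j w" J]
    by (intro mult_mono) auto
  \<comment> \<open>Row 1 is large and the b others are small. Leaving out row 1 gives a positive
    coordinate 0, leaving out row Suc b a negative one, so two summands point in opposite
    directions.\<close>
  define F where "F p = (if p = (1, 0) then {x. 1 < \<kappa> * x\<^sup>2} else {x. \<kappa> * x\<^sup>2 < 1 / real b})" for p :: "nat \<times> nat"
  define A where "A = {w :: nat \<times> nat \<Rightarrow> real. \<forall>p\<in>J \<times> {0}. w p \<in> F p}"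
  have op: "open (F p)" for p
    unfolding F_def by (auto intro!: open_Collect_less continuous_intros)
  have "sqrt (2 / \<kappa>) \<in> {x. 1 < \<kappa> * x\<^sup>2}" "0 \<in> {x. \<kappa> * x\<^sup>2 < 1 / real b}" using \<kappa> b by auto
  then have neF: "F p \<noteq> {}" for p by (auto simp only: F_def split: if_splits)
  have lt: "nrm d (?U w) < (\<Sum>j\<in>J. (1 / n) * ?R j w)" if w: "w \<in> A" for w
  proof -
    have one: "1 < \<kappa> * (w (1, 0))\<^sup>2" using w J by (auto simp: A_def F_def)
    have small: "\<kappa> * (w (i, 0))\<^sup>2 < 1 / real b" if "i \<in> J - {1}" for i
      using w that by (auto simp: A_def F_def split: if_splits)
    have "\<kappa> * (\<Sum>i\<in>J - {1}. (w (i, 0))\<^sup>2) < (\<Sum>i\<in>J - {1}. 1 / real b)"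
      unfolding sum_distrib_left using small J ne by (intro sum_strict_mono) auto
    also have "\<dots> = 1" using J b by simp
    finally have posc: "?u 1 w 0 > 0" by (simp add: step_unit_vector[OF d] power2_eq_square)
    have "\<kappa> * (w (1, 0))\<^sup>2 \<le> \<kappa> * (\<Sum>i\<in>J - {Suc b}. (w (i, 0))\<^sup>2)"
      using \<kappa> J b member_le_sum[of 1 "J - {Suc b}" "\<lambda>i. (w (i, 0))\<^sup>2"] by (intro mult_left_mono) auto
    then have negc: "?u (Suc b) w 0 < 0" using one by (simp add: step_unit_vector[OF d] power2_eq_square)
    have "nrm d (\<lambda>r. \<Sum>j\<in>J. ?u j w r) < (\<Sum>j\<in>J. ?R j w)"
      by (rule nrm_sum_strict[where u="\<lambda>j. ?u j w", OF J(1,3,4) _ posc negc]) (use d in simp)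
    then show ?thesis
      unfolding avg nrm_cmult sum_distrib_left[symmetric] using n by (simp add: divide_strict_right_mono)
  qed
  have conv: "(\<Sum>j\<in>J. (1 / n) * x j) powr s \<le> (\<Sum>j\<in>J. (1 / n) * x j powr s)" if "\<And>j. j \<in> J \<Longrightarrow> x j > 0" for x
    using convex_on_sum[OF J(1) J(5) powr_convex[OF s], of "\<lambda>_. 1 / n" x] that J n by (simp add: n_def)
  have pos: "AE w in P. \<forall>j\<in>J. ?R j w > 0"
    using J by (intro AE_finite_allI AE_nrm_step_pos[OF d _ ne \<kappa>]) auto
  have "step_moment (\<eta> / real (Suc b)) J d s < D.expectation (\<lambda>w. \<Sum>j\<in>J. (1 / n) * ?R j w powr s)"
    unfolding step_moment_def
  proof (rule D.integral_less_AE)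
    show "integrable P (\<lambda>w. nrm d (?U w) powr s)" by (rule intU)
    show "integrable P (\<lambda>w. \<Sum>j\<in>J. (1 / n) * ?R j w powr s)" using int by simp
    show "emeasure P A \<noteq> 0" unfolding A_def using J op neF by (intro box_pos) auto
    show "A \<in> sets P" unfolding A_def using J op by (intro box_sets) auto
    show "AE w in P. nrm d (?U w) powr s \<le> (\<Sum>j\<in>J. (1 / n) * ?R j w powr s)"
      using pos
    proof eventually_elim
      case (elim w)
      have "nrm d (?U w) powr s \<le> (\<Sum>j\<in>J. (1 / n) * ?R j w) powr s" using s le by (intro powr_mono2) auto
      then show ?case using conv[of "\<lambda>j. ?R j w"] elim by fastforce
    qed
    show "AE w in P. w \<in> A \<longrightarrow> nrm d (?U w) powr s \<noteq> (\<Sum>j\<in>J. (1 / n) * ?R j w powr s)"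
    proof -
      have "nrm d (?U w) powr s \<noteq> (\<Sum>j\<in>J. (1 / n) * ?R j w powr s)" if "\<forall>j\<in>J. ?R j w > 0" "w \<in> A" for w
      proof -
        have "nrm d (?U w) powr s < (\<Sum>j\<in>J. (1 / n) * ?R j w) powr s"
          using s lt[OF that(2)] by (intro powr_less_mono2) auto
        then show ?thesis using conv[of "\<lambda>j. ?R j w"] that(1) by fastforce
      qed
      then show ?thesis using pos by (auto elim: eventually_mono)
    qed
  qed
  also have "\<dots> = (\<Sum>j\<in>J. (1 / n) * step_moment \<kappa> (J - {j}) d s)"
    using int by (simp add: step_moment_def)
  also have "\<dots> = (\<Sum>j\<in>J. (1 / n) * step_moment \<kappa> {1..b} d s)"
    using law by (intro sum.cong) auto
  also have "\<dots> = step_moment \<kappa> {1..b} d s" using J n by (simp add: n_def)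
  finally show ?thesis by (simp add: J_def \<kappa>_def)
qed

lemma step_moment_batch:
  assumes d: "d \<ge> 1" and b: "1 \<le> b1" "b1 < b2" and \<eta>: "\<eta> > 0" and s: "s \<ge> 1"
  shows "step_moment (\<eta> / real b2) {1..b2} d s < step_moment (\<eta> / real b1) {1..b1} d s"
proof -
  have "1 \<le> b1 \<longrightarrow> step_moment (\<eta> / real b2) {1..b2} d s < step_moment (\<eta> / real b1) {1..b1} d s"
    using b(2)
  proof (induction rule: less_Suc_induct)
    case (1 i)
    then show ?case using step_moment_batch_Suc[OF d _ \<eta> s, of i] by simp
  next
    case (2 i j k)
    then show ?case by auto
  qed
  then show ?thesis using b(1) by simp
qed

lemma emeasure_N_scale:
  assumes [measurable]: "F \<in> sets borel"
  shows "emeasure N F = emeasure (density lborel (normal_density 0 (sqrt 1))) ((\<lambda>x. sqrt v * x) -` F)"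
proof -
  have dens: "sqrt v * normal_density 0 (sqrt v) (sqrt v * x) = normal_density 0 1 x" for x
    using v_pos by (simp add: normal_density_def power_mult_distrib real_sqrt_mult field_simps)
  have "emeasure N F = (\<integral>\<^sup>+x. ennreal (normal_density 0 (sqrt v) x) * indicator F x \<partial>lborel)"
    by (subst emeasure_density) auto
  also have "\<dots> = ennreal \<bar>sqrt v\<bar> * (\<integral>\<^sup>+x. ennreal (normal_density 0 (sqrt v) (0 + sqrt v * x)) * indicator F (0 + sqrt v * x) \<partial>lborel)"
    using v_pos by (intro nn_integral_real_affine) auto
  also have "\<dots> = (\<integral>\<^sup>+x. ennreal (normal_density 0 1 x) * indicator F (sqrt v * x) \<partial>lborel)"
    using v_pos by (subst nn_integral_cmult[symmetric]) (auto simp: mult.assoc[symmetric] ennreal_mult'[symmetric] dens)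
  also have "\<dots> = emeasure (density lborel (normal_density 0 1)) ((\<lambda>x. sqrt v * x) -` F)"
    by (subst emeasure_density) (auto simp: indicator_def intro!: nn_integral_cong measurable_sets_borel[of _ borel])
  finally show ?thesis by simp
qed

text \<open>Data of variance v are sqrt v times standard data, and the step is quadratic in them, so
  v merges with \<kappa>. Different variances are thereby compared on one probability space.\<close>

lemma step_moment_scale:
  "step_moment \<kappa> I d s = gaussian_data.step_moment 1 (\<kappa> * v) I d s"
proof -
  interpret S: gaussian_data 1 by unfold_locales simp
  let ?S = "\<lambda>w i. sqrt v * w i" 
  have m: "?S \<in> S.P \<rightarrow>\<^sub>M P"
    by (rule measurable_into_P) simp
  have "distr S.P P ?S = P"
  proof (rule P_eqI)
    fix J F assume J: "finite (J :: (nat \<times> nat) set)" and F: "\<And>j. j \<in> J \<Longrightarrow> F j \<in> sets (borel :: real measure)"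
    have vF: "(\<lambda>x. sqrt v * x) -` F j \<in> sets borel" if "j \<in> J" for j
      using F[OF that] by (intro measurable_sets_borel[of _ borel]) auto
    have "emeasure (distr S.P P ?S) {w. \<forall>j\<in>J. w j \<in> F j} = emeasure S.P {w. \<forall>j\<in>J. w j \<in> (\<lambda>x. sqrt v * x) -` F j}"
      by (subst emeasure_distr[OF m box_sets[OF J F]]) (auto intro!: arg_cong2[where f=emeasure])
    also have "\<dots> = (\<Prod>j\<in>J. emeasure S.N ((\<lambda>x. sqrt v * x) -` F j))"
      by (rule S.emeasure_P_box[OF J vF])
    also have "\<dots> = (\<Prod>j\<in>J. emeasure N (F j))"
      using F by (intro prod.cong refl emeasure_N_scale[symmetric])
    finally show "emeasure (distr S.P P ?S) {w. \<forall>j\<in>J. w j \<in> F j} = (\<Prod>j\<in>J. emeasure N (F j))" .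
  qed simp
  then have "step_moment \<kappa> I d s = (\<integral>w. nrm d (step \<kappa> I d w (unit_vector 0)) powr s \<partial>distr S.P P ?S)"
    by (simp add: step_moment_def)
  also have "\<dots> = (\<integral>w. nrm d (step \<kappa> I d (?S w) (unit_vector 0)) powr s \<partial>S.P)"
    by (rule integral_distr[OF m]) measurable
  also have "\<dots> = S.step_moment (\<kappa> * v) I d s"
  proof -
    have "step \<kappa> I d (?S w) u = step (\<kappa> * v) I d w u" for w u
    proof
      fix p
      have "(\<Sum>q<d. sqrt v * w (i, q) * u q) = sqrt v * (\<Sum>q<d. w (i, q) * u q)" for i
        by (simp add: sum_distrib_left mult.assoc)
      moreover have "sqrt v * x * (sqrt v * y) = v * (x * y)" for x y
        using v_pos by (metis mult.assoc mult.left_commute real_sqrt_mult_self abs_of_pos)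
      ultimately show "step \<kappa> I d (?S w) u p = step (\<kappa> * v) I d w u p"
        by (simp only: step_def sum_distrib_left[symmetric] mult.assoc)
    qed
    then show ?thesis by (simp add: S.step_moment_def)
  qed
  finally show ?thesis .
qed

end

section \<open>From moments to tail-indices\<close>

lemma (in sgd) g_eq: "rv.g s = step_moment (\<eta> / real b) {1..b} d s"
  by (simp add: rv.g_def step_moment_def R_def)

lemma admissible_sgd: "admissible \<eta> v b d \<Longrightarrow> sgd v \<eta> b d"
  by (simp add: admissible_def sgd_def sgd_axioms_def gaussian_data_def)

text \<open>At the tail-index of b1 the first moment function equals 1, so the one for b2 is below 1
  there, which places the point to the left of its root.\<close>

lemma tail_index_batch:
  assumes a1: "admissible \<eta> v b1 d" and a2: "admissible \<eta> v b2 d" and "b1 < b2" "tail_index \<eta> v b1 d \<ge> 1"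
  shows "tail_index \<eta> v b1 d < tail_index \<eta> v b2 d"
proof -
  interpret s1: sgd v \<eta> b1 d by (rule admissible_sgd[OF a1])
  interpret s2: sgd v \<eta> b2 d by (rule admissible_sgd[OF a2])
  have "s2.rv.g (tail_index \<eta> v b1 d) < s1.rv.g (tail_index \<eta> v b1 d)"
    unfolding s1.g_eq s2.g_eq using assms s1.\<eta>_pos s1.b_pos s1.d_pos by (intro s1.step_moment_batch)
  then show ?thesis
    using s1.tail_index_root[OF a1] by (intro s2.rv.less_root[OF s2.tail_index_root[OF a2]]) auto
qed

text \<open>Stepsize and variance are handled together. At the first tail-index the chord inequality
  reads 1 < t g + (1 - t), with g the second moment function at that point; hence g > 1, and the
  point lies to the right of the second root.\<close>

lemma tail_index_stepsize_variance:
  assumes a1: "admissible \<eta>1 v1 b d" and a2: "admissible \<eta>2 v2 b d" and less: "\<eta>1 * v1 < \<eta>2 * v2"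
    and ge: "tail_index \<eta>1 v1 b d \<ge> 1"
  shows "tail_index \<eta>2 v2 b d < tail_index \<eta>1 v1 b d"
proof -
  interpret s1: sgd v1 \<eta>1 b d by (rule admissible_sgd[OF a1])
  interpret s2: sgd v2 \<eta>2 b d by (rule admissible_sgd[OF a2])
  interpret S: gaussian_data 1 by unfold_locales simp
  define \<alpha> where "\<alpha> = tail_index \<eta>1 v1 b d"
  define t where "t = (\<eta>1 / real b * v1) / (\<eta>2 / real b * v2)"
  have b: "real b > 0" using s1.b_pos by simp
  have lt: "\<eta>1 / real b * v1 < \<eta>2 / real b * v2"
    using less b by (simp add: divide_strict_right_mono)
  have pos: "0 < \<eta>1 / real b * v1" using b s1.\<eta>_pos s1.v_pos by simp
  then have t: "t > 0" using lt unfolding t_def by (intro divide_pos_pos) auto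
  have "1 = s1.rv.g \<alpha>" using s1.tail_index_root[OF a1] by (simp add: \<alpha>_def)
  also have "\<dots> = S.step_moment (\<eta>1 / real b * v1) {1..b} d \<alpha>"
    by (simp only: s1.g_eq s1.step_moment_scale)
  also have "\<dots> < t * S.step_moment (\<eta>2 / real b * v2) {1..b} d \<alpha> + (1 - t)"
    unfolding t_def using s1.d_pos s1.b_pos pos lt ge by (intro S.step_moment_stepsize) (auto simp: \<alpha>_def)
  also have "S.step_moment (\<eta>2 / real b * v2) {1..b} d \<alpha> = s2.rv.g \<alpha>"
    by (simp only: s2.g_eq s2.step_moment_scale)
  finally have "t * 1 < t * s2.rv.g \<alpha>" by simp
  then have "1 < s2.rv.g \<alpha>" using t by (simp only: mult_less_cancel_left_pos)
  then show ?thesis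
    using s1.tail_index_root[OF a1] by (intro s2.rv.root_less[OF s2.tail_index_root[OF a2]]) (auto simp: \<alpha>_def)
qed

lemma tail_index_dim:
  assumes a1: "admissible \<eta> v b d1" and a2: "admissible \<eta> v b d2" and "d1 < d2"
  shows "tail_index \<eta> v b d2 < tail_index \<eta> v b d1"
proof -
  interpret s1: sgd v \<eta> b d1 by (rule admissible_sgd[OF a1])
  interpret s2: sgd v \<eta> b d2 by (rule admissible_sgd[OF a2])
  have "s1.rv.g (tail_index \<eta> v b d1) < s2.rv.g (tail_index \<eta> v b d1)"
    unfolding s1.g_eq s2.g_eq
    using assms s1.\<eta>_pos s1.b_pos s1.d_pos s1.tail_index_root[OF a1] by (intro s1.step_moment_dim) auto
  then show ?thesis
    using s1.tail_index_root[OF a1] by (intro s2.rv.root_less[OF s2.tail_index_root[OF a2]]) auto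
qed

theorem theorem4:
  shows
   "(\<forall>\<eta> v d b1 b2. admissible \<eta> v b1 d \<and> admissible \<eta> v b2 d \<and> b1 < b2 \<and>
        tail_index \<eta> v b1 d \<ge> 1 \<and> tail_index \<eta> v b2 d \<ge> 1
        \<longrightarrow> tail_index \<eta> v b1 d < tail_index \<eta> v b2 d)
  \<and> (\<forall>\<eta>1 \<eta>2 v b d. admissible \<eta>1 v b d \<and> admissible \<eta>2 v b d \<and> \<eta>1 < \<eta>2 \<and>
        tail_index \<eta>1 v b d \<ge> 1 \<and> tail_index \<eta>2 v b d \<ge> 1
        \<longrightarrow> tail_index \<eta>2 v b d < tail_index \<eta>1 v b d)
  \<and> (\<forall>\<eta> v1 v2 b d. admissible \<eta> v1 b d \<and> admissible \<eta> v2 b d \<and> v1 < v2 \<and>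
        tail_index \<eta> v1 b d \<ge> 1 \<and> tail_index \<eta> v2 b d \<ge> 1
        \<longrightarrow> tail_index \<eta> v2 b d < tail_index \<eta> v1 b d)
  \<and> (\<forall>\<eta> v b d1 d2. admissible \<eta> v b d1 \<and> admissible \<eta> v b d2 \<and> d1 < d2
        \<longrightarrow> tail_index \<eta> v b d2 < tail_index \<eta> v b d1)"
proof (intro conjI allI impI; elim conjE)
  show "tail_index \<eta> v b1 d < tail_index \<eta> v b2 d"
    if "admissible \<eta> v b1 d" "admissible \<eta> v b2 d" "b1 < b2" "1 \<le> tail_index \<eta> v b1 d" for \<eta> v d b1 b2
    using that by (rule tail_index_batch)
  show "tail_index \<eta>2 v b d < tail_index \<eta>1 v b d"
    if "admissible \<eta>1 v b d" "admissible \<eta>2 v b d" "\<eta>1 < \<eta>2" "1 \<le> tail_index \<eta>1 v b d" for \<eta>1 \<eta>2 v b d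
    using that by (intro tail_index_stepsize_variance) (auto simp: admissible_def)
  show "tail_index \<eta> v2 b d < tail_index \<eta> v1 b d"
    if "admissible \<eta> v1 b d" "admissible \<eta> v2 b d" "v1 < v2" "1 \<le> tail_index \<eta> v1 b d" for \<eta> v1 v2 b d
    using that by (intro tail_index_stepsize_variance) (auto simp: admissible_def)
  show "tail_index \<eta> v b d2 < tail_index \<eta> v b d1"
    if "admissible \<eta> v b d1" "admissible \<eta> v b d2" "d1 < d2" for \<eta> v b d1 d2
    using that by (rule tail_index_dim)
qed

end
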